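(* Let $X$ be a finite dimensional normed space, let $\delta>0$, $\epsilon>0$, $\lambda^\ast\in\mathbb{R}$, and for every $\lambda\in[\lambda^\ast-\delta,\lambda^\ast+\delta]$ let $f_\lambda:B_X(0,\epsilon)\to\mathbb{R}$ be a function of class $C^1$. Assume that a) the functions $(\lambda,u)\mapsto f_\lambda(u)$ and $(\lambda,u)\mapsto f'_\lambda(u)$ are continuous on $[\lambda^\ast-\delta,\lambda^\ast+\delta]\times B_X(0,\epsilon)$; b) $u=0$ is a critical point of $f_{\lambda^\ast}$; c) $f_\lambda$ has a local minimum (resp. maximum) at zero for every $\lambda\in(\lambda^\ast,\lambda^\ast+\delta]$ and a local maximum (resp. minimum) at zero for every $\lambda\in[\lambda^\ast-\delta,\lambda^\ast)$. Then at least one of the following assertions holds: i) $u=0$ is not an isolated critical point of $f_{\lambda^\ast}$. ii) $u=0$ is an isolated critical point of $f_{\lambda^\ast}$ which is a saddle point, and for every $\lambda\ne\lambda^\ast$ in a neighborhood of $\lambda^\ast$ there is a nontrivial critical point $u_\lambda\neq 0$ of $f_\lambda$, with $u_\lambda\to 0$ as $\lambda\to\lambda^\ast$. iii* ) $u=0$ is an isolated critical point of $f_{\lambda^\ast}$ which is a local minimizer (resp. maximizer), and for any given neighborhood $W$ of $0$ in $B_X(0,\epsilon)$ there is a one-sided (right or left) neighborhood $\Lambda^0$ of $\lambda^\ast$ such that $u=0$ is a local maximizer (resp. minimizer) of $f_\lambda$ for each $\lambda\in\Lambda^0\setminus\{\lambda^\ast\}$, and every $f_\lambda$ with $\lambda\in\Lambda^0\setminus\{\lambda^\ast\}$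 has at least two nontrivial critical points $p_1,p_2$ in $W$. Moreover, $p_1$ and $p_2$ can be chosen such that $f_\lambda(p_2)>f_\lambda(p_1)$ (resp. $f_\lambda(p_2)<f_\lambda(p_1)$) and $p_1$ is a strict local minimizer (resp. maximizer) of $f_\lambda$ in $W$, provided that $f_\lambda$ has only finitely many critical points in $W$ and $\dim X>1$. In particular, $(\lambda^\ast,0)\in[\lambda^\ast-\delta,\lambda^\ast+\delta]\times B_X(0,\epsilon)$ is a bifurcation point of $f'_\lambda(u)=0$.
   Context: $B_X(0,\epsilon)$ is the open ball of radius $\epsilon$ centered at $0$ in $X$. "(resp.)" in c) offers two alternative hypotheses; "(resp.)" in iii* ) offers two alternative cases, independent of those in c). A critical point is nontrivial if it is different from $0$. The critical point $0$ of $f_{\lambda^\ast}$ is a saddle point if $f_{\lambda^\ast}-f_{\lambda^\ast}(0)$ takes both positive and negative values in every neighborhood of $0$. A one-sided neighborhood of $\lambda^\ast$ is an interval containing a set of the form $[\lambda^\ast,\lambda^\ast+\eta)$ (right) or $(\lambda^\ast-\eta,\lambda^\ast]$ (left), $\eta>0$, and lying on that side of $\lambda^\ast$ (inside $[\lambda^\ast-\delta,\lambda^\ast+\delta]$). $(\lambda^\ast,0)$ is a bifurcation point of $f'_\lambda(u)=0$ if every neighborhood of $(\lambda^\ast,0)$ in $[\lambda^\ast-\delta,\lambda^\ast+\delta]\times B_X(0,\epsilon)$ contains a point $(\lambda,u)$ with $u\neq0$ and $f'_\lambda(u)=0$. *)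

theory Defs
  imports "HOL-Analysis.Analysis"
begin

text \<open>
  In the first group of definitions, \<open>g\<close> is a function on an open set \<open>U\<close>; since HOL functions
  are total, the domain \<open>U\<close> is an explicit argument and the values of \<open>g\<close> outside \<open>U\<close> play no role.
\<close>

definition critical_points :: "'a::real_normed_vector set \<Rightarrow> ('a \<Rightarrow> real) \<Rightarrow> 'a set" where
  "critical_points U g = {u \<in> U. (g has_derivative (\<lambda>_. 0)) (at u)}"

definition isolated_critical_point :: "'a::real_normed_vector set \<Rightarrow> ('a \<Rightarrow> real) \<Rightarrow> 'a \<Rightarrow> bool" where
  "isolated_critical_point U g u \<longleftrightarrow> u isolated_in (critical_points U g)"

definition local_minimizer :: "'a::topological_space set \<Rightarrow> ('a \<Rightarrow> real) \<Rightarrow> 'a \<Rightarrow> bool" where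
  "local_minimizer U g u \<longleftrightarrow> u \<in> U \<and> (\<forall>\<^sub>F v in at u within U. g u \<le> g v)"

definition local_maximizer :: "'a::topological_space set \<Rightarrow> ('a \<Rightarrow> real) \<Rightarrow> 'a \<Rightarrow> bool" where
  "local_maximizer U g u \<longleftrightarrow> u \<in> U \<and> (\<forall>\<^sub>F v in at u within U. g v \<le> g u)"

definition strict_local_minimizer :: "'a::topological_space set \<Rightarrow> ('a \<Rightarrow> real) \<Rightarrow> 'a \<Rightarrow> bool" where
  "strict_local_minimizer U g u \<longleftrightarrow> u \<in> U \<and> (\<forall>\<^sub>F v in at u within U. g u < g v)"

definition strict_local_maximizer :: "'a::topological_space set \<Rightarrow> ('a \<Rightarrow> real) \<Rightarrow> 'a \<Rightarrow> bool" where
  "strict_local_maximizer U g u \<longleftrightarrow> u \<in> U \<and> (\<forall>\<^sub>F v in at u within U. g v < g u)"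

definition saddle_point :: "'a::real_normed_vector set \<Rightarrow> ('a \<Rightarrow> real) \<Rightarrow> 'a \<Rightarrow> bool" where
  "saddle_point U g u \<longleftrightarrow> u \<in> critical_points U g \<and>
     (\<forall>N. open N \<and> u \<in> N \<longrightarrow> (\<exists>v\<in>N \<inter> U. g v - g u > 0) \<and> (\<exists>v\<in>N \<inter> U. g v - g u < 0))"

definition one_sided_neighborhood :: "real \<Rightarrow> real \<Rightarrow> real set \<Rightarrow> bool" where
  "one_sided_neighborhood \<delta> l \<Lambda> \<longleftrightarrow> is_interval \<Lambda> \<and>
     (\<exists>\<eta>>0. {l..<l + \<eta>} \<subseteq> \<Lambda> \<and> \<Lambda> \<subseteq> {l..l + \<delta>} \<or> {l - \<eta><..l} \<subseteq> \<Lambda> \<and> \<Lambda> \<subseteq> {l - \<delta>..l})"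

text \<open>
  \<open>bifurcation_point I U F l\<close>: the point \<open>(l, 0)\<close> of \<open>I \<times> U\<close> is a bifurcation point of the
  equation \<open>F \<mu> u = 0\<close>, with neighborhoods taken relative to \<open>I \<times> U\<close>.
\<close>

definition bifurcation_point ::
    "real set \<Rightarrow> 'a::real_normed_vector set \<Rightarrow> (real \<Rightarrow> 'a \<Rightarrow> 'b::zero) \<Rightarrow> real \<Rightarrow> bool" where
  "bifurcation_point I U F l \<longleftrightarrow> (l, 0) \<in> I \<times> U \<and>
     (\<forall>N. openin (top_of_set (I \<times> U)) N \<and> (l, 0) \<in> N \<longrightarrow>
        (\<exists>\<mu> u. (\<mu>, u) \<in> N \<and> u \<noteq> 0 \<and> F \<mu> u = 0))"

end

theory Submission
  imports Defs
begin

text \<open>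
  The proof rests on one mountain pass lemma (\<open>mountain_pass\<close>), proved by watching how the
  connected component of a strict minimum in the sublevel sets grows with the level: the
  component can change abruptly only at a level that contains a critical point, because near a
  regular point of the level the sublevel set has only one local component.

  Suppose that \<open>0\<close> is an isolated critical point of \<open>f l\<close>. There are three cases.

  If \<open>0\<close> is neither a local minimum nor a local maximum of \<open>f l\<close>, then it is a saddle point. When \<open>0\<close> is a
  local minimum of \<open>f \<mu>\<close> and \<open>\<mu>\<close> is close to \<open>l\<close>, some point near \<open>0\<close> is lower than \<open>0\<close>, and a
  mountain pass between the two gives a nontrivial critical point near \<open>0\<close>. A penalty term
  prevents the pass from escaping to the boundary
  (\<open>nontrivial_critical_point_if_minimum_lost\<close>). When \<open>0\<close> is a local maximum of \<open>f \<mu>\<close>, the same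
  argument applies to \<open>- f\<close>. So there are nontrivial critical points on both sides.

  If \<open>0\<close> is a local minimum of \<open>f l\<close>, it is strict, and on one side of \<open>l\<close> it becomes a local
  maximum of \<open>f \<mu>\<close>. Then \<open>f \<mu>\<close> has the shape of a moat around \<open>0\<close>: its lowest point \<open>p1\<close> is a
  nontrivial critical point, and crossing the moat from \<open>0\<close> outwards as high as possible leads
  to a critical point \<open>p2\<close>, by the mountain pass lemma for \<open>- f \<mu>\<close>. The crossing can avoid the
  lowest points, if they are finite in number and the dimension is larger than \<open>1\<close>, and then \<open>p2\<close>
  is higher than \<open>p1\<close> (\<open>two_critical_points_if_strict_minimum_becomes_maximum\<close>).

  If \<open>0\<close> is a local maximum of \<open>f l\<close>, apply this to \<open>- f\<close>. In each case nontrivial critical points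
  accumulate at \<open>(l, 0)\<close>, and they do so by definition if \<open>0\<close> is not isolated.
\<close>

section \<open>Compactness of balls in a finite-dimensional normed space\<close>

text \<open>
  Induction on the spanning set. If \<open>a\<close> lies outside \<open>span S\<close>, which is closed by the induction
  hypothesis, then \<open>a\<close> has a positive distance \<open>d\<close> from it, so the coefficient of \<open>a\<close> in a vector
  \<open>x\<close> of \<open>span (insert a S)\<close> is at most \<open>norm x / d\<close>. The coefficients of a bounded sequence are
  therefore bounded, and two successive extractions give the limit.
\<close>

lemma bounded_seq_in_finite_span_convergent_subseq:
  fixes S :: "'a::real_normed_vector set"
  assumes "finite S" and "range X \<subseteq> span S" and "bounded (range X)"
  shows "\<exists>x\<in>span S. \<exists>r. strict_mono (r :: nat \<Rightarrow> nat) \<and> (X \<circ> r) \<longlonglongrightarrow> x"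
  using assms
proof (induction S arbitrary: X rule: finite_induct)
  case empty
  then have "X = (\<lambda>_. 0)" by auto
  then show ?case by (auto intro!: exI[of _ id] simp: strict_mono_def)
next
  case (insert a S)
  show ?case
  proof (cases "a \<in> span S")
    case True
    then show ?thesis using insert by (simp add: span_redundant)
  next
    case False
    have "closed (span S)"
      unfolding closed_sequential_limits
    proof (intro allI impI, elim conjE)
      fix Y and y assume Y: "\<forall>n. Y n \<in> span S" "Y \<longlonglongrightarrow> y"
      then obtain z r where z: "z \<in> span S" "strict_mono (r :: nat \<Rightarrow> nat)" "(Y \<circ> r) \<longlonglongrightarrow> z"
        using insert.IH[of Y] convergent_imp_bounded[OF Y(2)] by blast
      then show "y \<in> span S"
        using LIMSEQ_subseq_LIMSEQ[OF Y(2) z(2)] LIMSEQ_unique by blast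
    qed
    then have "open (- span S)" by (rule open_Compl)
    then obtain d where "d > 0" "ball a d \<subseteq> - span S"
      using False open_contains_ball_eq[of "- span S" a] by auto
    then have d: "d > 0" "\<And>y. y \<in> span S \<Longrightarrow> d \<le> dist a y" by force+
    have "\<exists>t. X n - t *\<^sub>R a \<in> span S" for n
      using insert.prems(1) span_breakdown_eq by blast
    then obtain t where t: "\<And>n. X n - t n *\<^sub>R a \<in> span S" by metis
    have t_bound: "\<bar>t n\<bar> * d \<le> norm (X n)" for n
    proof (cases "t n = 0")
      case True
      then show ?thesis by simp
    next
      case False
      have "- (1 / t n) *\<^sub>R (X n - t n *\<^sub>R a) \<in> span S"
        using t span_mul by blast
      from d(2)[OF this] have "d \<le> norm ((1 / t n) *\<^sub>R X n)"
        using False by (simp add: dist_norm algebra_simps)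
      then show ?thesis using False by (simp add: field_simps)
    qed
    obtain b where b: "\<And>n. norm (X n) \<le> b"
      using insert.prems(2) unfolding bounded_iff by auto
    have "bounded (range t)"
      unfolding bounded_iff
    proof (intro exI ballI)
      fix s assume "s \<in> range t"
      then obtain n where "s = t n" by auto
      with t_bound[of n] b[of n] \<open>d > 0\<close> show "norm s \<le> b / d"
        by (simp add: field_simps)
    qed
    then obtain s p where p: "strict_mono (p :: nat \<Rightarrow> nat)" "(t \<circ> p) \<longlonglongrightarrow> s"
      using bounded_imp_convergent_subsequence by blast
    define Y where "Y = (\<lambda>n. X (p n) - t (p n) *\<^sub>R a)"
    obtain c where c: "\<And>n. norm (t (p n)) \<le> c"
      using convergent_imp_bounded[OF p(2)] unfolding bounded_iff by auto
    have "norm (Y n) \<le> b + c * norm a" for n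
      using b[of "p n"] c[of n] norm_triangle_ineq4[of "X (p n)" "t (p n) *\<^sub>R a"]
        mult_right_mono[of "\<bar>t (p n)\<bar>" c "norm a"] by (auto simp: Y_def)
    then have "bounded (range Y)" by (auto simp: bounded_iff)
    moreover have "range Y \<subseteq> span S" using t by (auto simp: Y_def)
    ultimately obtain y q where
      q: "y \<in> span S" "strict_mono (q :: nat \<Rightarrow> nat)" "(Y \<circ> q) \<longlonglongrightarrow> y"
      using insert.IH by blast
    have "(\<lambda>n. (Y \<circ> q) n + ((t \<circ> p) \<circ> q) n *\<^sub>R a) \<longlonglongrightarrow> y + s *\<^sub>R a"
      using LIMSEQ_subseq_LIMSEQ[OF p(2) q(2)] q(3) by (intro tendsto_intros)
    then have "(X \<circ> (p \<circ> q)) \<longlonglongrightarrow> y + s *\<^sub>R a"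
      by (simp add: Y_def o_def)
    moreover have "strict_mono (p \<circ> q)" using p q by (simp add: strict_mono_o)
    moreover have "y + s *\<^sub>R a \<in> span (insert a S)"
      unfolding span_breakdown_eq using q(1) by (intro exI[of _ s]) simp
    ultimately show ?thesis by blast
  qed
qed

lemma compact_cball_if_finite_span:
  fixes S :: "'a::real_normed_vector set"
  assumes "finite S" and "span S = UNIV"
  shows "compact (cball (c :: 'a) r)"
  unfolding compact_def
proof (intro allI impI)
  fix X :: "nat \<Rightarrow> 'a" assume X: "\<forall>n. X n \<in> cball c r"
  then have "range X \<subseteq> cball c r" by auto
  then have "bounded (range X)" using bounded_cball bounded_subset by blast
  then obtain x p where p: "strict_mono (p :: nat \<Rightarrow> nat)" "(X \<circ> p) \<longlonglongrightarrow> x"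
    using bounded_seq_in_finite_span_convergent_subseq[OF assms(1), of X] assms(2) by auto
  then have "x \<in> cball c r"
    using X closed_sequentially[OF closed_cball, of "X \<circ> p"] by auto
  with p show "\<exists>l\<in>cball c r. \<exists>p. strict_mono p \<and> (X \<circ> p) \<longlonglongrightarrow> l" by blast
qed

lemma positive_on_compact:
  fixes g :: "'a::topological_space \<Rightarrow> real"
  assumes "compact K" "continuous_on K g" "\<And>x. x \<in> K \<Longrightarrow> 0 < g x"
  obtains c where "c > 0" "\<And>x. x \<in> K \<Longrightarrow> c \<le> g x"
proof (cases "K = {}")
  case True
  then show thesis using that[of 1] by simp
next
  case False
  then obtain x where "x \<in> K" "\<forall>y\<in>K. g x \<le> g y"
    using continuous_attains_inf assms by blast
  then show thesis using that[of "g x"] assms(3) by blast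
qed

section \<open>A mountain pass lemma\<close>

text \<open>
  One direction \<open>v\<close> serves a whole neighborhood of \<open>x\<close>, and it decreases both functions at once.
  This is what regularity of a point means in the mountain pass lemma. It makes sense for functions
  that are not differentiable, such as a \<open>C\<^sup>1\<close> function plus a multiple of the norm.
\<close>

definition common_descent_direction ::
    "('a::real_normed_vector \<Rightarrow> real) \<Rightarrow> ('a \<Rightarrow> real) \<Rightarrow> 'a \<Rightarrow> bool" where
  "common_descent_direction h k x \<longleftrightarrow>
     (\<exists>v. \<exists>\<rho>>0. \<forall>y t. dist x y < \<rho> \<and> 0 < t \<and> t < \<rho> \<longrightarrow>
        h (y + t *\<^sub>R v) < h y \<and> k (y + t *\<^sub>R v) < k y)"

text \<open>
  The derivative is larger than the Lipschitz constant \<open>M\<close> in some direction \<open>v\<close>, and stays so on a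
  neighborhood; along \<open>v\<close> the perturbation \<open>q\<close> cannot compensate the decrease of \<open>g\<close>.
\<close>

lemma common_descent_direction_add_small_Lipschitz:
  fixes g q :: "'a::real_normed_vector \<Rightarrow> real" and g' :: "'a \<Rightarrow> 'a \<Rightarrow>\<^sub>L real"
  assumes "open U" and "x \<in> U"
    and deriv: "\<And>y. y \<in> U \<Longrightarrow> (g has_derivative blinfun_apply (g' y)) (at y)"
    and cont: "continuous_on U g'"
    and lip: "M-lipschitz_on U q" and small: "M < norm (g' x)"
  shows "common_descent_direction (\<lambda>y. g y + q y) g x"
proof -
  have "0 \<le> M" using lip lipschitz_on_nonneg by blast
  then obtain w where w: "M * norm w < \<bar>blinfun_apply (g' x) w\<bar>"
    using small norm_blinfun_bound[of M "g' x"] by (force simp: not_less[symmetric])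
  define v where "v = (if blinfun_apply (g' x) w < 0 then w else - w)"
  have v: "blinfun_apply (g' x) v < - M * norm v"
    using w by (auto simp: v_def blinfun.minus_right)
  have "isCont (\<lambda>y. blinfun_apply (g' y) v) x"
    using cont \<open>open U\<close> \<open>x \<in> U\<close> by (auto intro!: continuous_intros simp: continuous_on_eq_continuous_at)
  then have "\<forall>\<^sub>F y in nhds x. blinfun_apply (g' y) v < - M * norm v"
    using v by (metis continuous_at_imp_continuous_at_within isCont_def order_tendstoD(2) tendsto_at_iff_tendsto_nhds)
  moreover have "\<forall>\<^sub>F y in nhds x. y \<in> U"
    using \<open>open U\<close> \<open>x \<in> U\<close> by (rule eventually_nhds_in_open)
  ultimately have "\<forall>\<^sub>F y in nhds x. y \<in> U \<and> blinfun_apply (g' y) v < - M * norm v"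
    by eventually_elim auto
  then obtain \<sigma> where \<sigma>: "\<sigma> > 0"
    "\<And>y. dist y x < \<sigma> \<Longrightarrow> y \<in> U \<and> blinfun_apply (g' y) v < - M * norm v"
    unfolding eventually_nhds_metric by blast
  define \<rho> where "\<rho> = \<sigma> / (1 + norm v)"
  have "\<rho> > 0" using \<sigma>(1) by (simp add: \<rho>_def add_pos_nonneg)
  have \<rho>: "\<rho> + \<rho> * norm v = \<sigma>"
    by (simp add: \<rho>_def field_simps add_nonneg_eq_0_iff)
  have "g (y + t *\<^sub>R v) + q (y + t *\<^sub>R v) < g y + q y \<and> g (y + t *\<^sub>R v) < g y"
    if y: "dist x y < \<rho>" and t: "0 < t" "t < \<rho>" for y t
  proof -
    have near: "y + s *\<^sub>R v \<in> U \<and> blinfun_apply (g' (y + s *\<^sub>R v)) v < - M * norm v"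
      if s: "0 \<le> s" "s \<le> t" for s
    proof (rule \<sigma>(2))
      have "norm (y + s *\<^sub>R v - x) \<le> norm (y - x) + s * norm v"
        using norm_triangle_ineq[of "y - x" "s *\<^sub>R v"] s by (simp add: algebra_simps)
      also have "\<dots> < \<rho> + \<rho> * norm v"
        using y s t mult_right_mono[of s \<rho> "norm v"] by (simp add: dist_norm norm_minus_commute)
      finally show "dist (y + s *\<^sub>R v) x < \<sigma>" by (simp add: \<rho> dist_norm)
    qed
    have "((\<lambda>s. g (y + s *\<^sub>R v)) has_derivative (\<lambda>s. blinfun_apply (g' (y + s0 *\<^sub>R v)) (s *\<^sub>R v)))
      (at s0 within {0..t})" if "0 \<le> s0" "s0 \<le> t" for s0
      using near[OF that]
      by (intro has_derivative_compose[where g = g and f = "\<lambda>s. y + s *\<^sub>R v", OF _ deriv])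
         (auto intro!: derivative_eq_intros)
    from mvt_simple[OF t(1) this] obtain s where s: "s \<in> {0<..<t}"
      and eq: "g (y + t *\<^sub>R v) - g y = blinfun_apply (g' (y + s *\<^sub>R v)) (t *\<^sub>R v)"
      by auto
    have "t * blinfun_apply (g' (y + s *\<^sub>R v)) v < t * (- M * norm v)"
      using near[of s] s t by (intro mult_strict_left_mono) auto
    then have g: "g (y + t *\<^sub>R v) - g y < - (M * (t * norm v))"
      by (simp add: eq blinfun.scaleR_right algebra_simps)
    have "\<bar>q (y + t *\<^sub>R v) - q y\<bar> \<le> M * (t * norm v)"
      using lipschitz_onD[OF lip, of "y + t *\<^sub>R v" y] near[of t] near[of 0] t
      by (simp add: dist_norm)
    moreover have "0 \<le> M * (t * norm v)" using \<open>0 \<le> M\<close> t by simp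
    ultimately show ?thesis using g by linarith
  qed
  with \<open>\<rho> > 0\<close> show ?thesis
    unfolding common_descent_direction_def by blast
qed

text \<open>
  Points below the level of \<open>x\<close> can be pushed along the descent direction \<open>v\<close> without leaving the
  sublevel set, until they all arrive in one small ball around \<open>x + \<tau> v\<close> that lies inside it.
  So the passage through the level of \<open>x\<close> does not join different components near \<open>x\<close>.
\<close>

lemma sublevel_connected_near_descent_point:
  fixes h k :: "'a::real_normed_vector \<Rightarrow> real"
  assumes "open U" and "x \<in> U" and cont: "continuous_on U h"
    and "common_descent_direction h k x"
  obtains \<sigma> where "\<sigma> > 0"
    and "\<And>y z. y \<in> ball x \<sigma> \<Longrightarrow> z \<in> ball x \<sigma> \<Longrightarrow> h y < h x \<Longrightarrow> h z < h x \<Longrightarrow>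
           connected_component {u \<in> U. h u < h x} y z"
proof -
  obtain v \<rho>0 where "\<rho>0 > 0"
    and desc0: "\<And>y t. dist x y < \<rho>0 \<Longrightarrow> 0 < t \<Longrightarrow> t < \<rho>0 \<Longrightarrow> h (y + t *\<^sub>R v) < h y"
    using assms(4) unfolding common_descent_direction_def by blast
  obtain \<rho>1 where "\<rho>1 > 0" "ball x \<rho>1 \<subseteq> U"
    using assms(1,2) open_contains_ball by blast
  define \<rho> where "\<rho> = min \<rho>0 \<rho>1"
  have "\<rho> > 0" "ball x \<rho> \<subseteq> U" using \<open>\<rho>0 > 0\<close> \<open>\<rho>1 > 0\<close> \<open>ball x \<rho>1 \<subseteq> U\<close> by (auto simp: \<rho>_def)
  have desc: "h (y + t *\<^sub>R v) < h y" if "dist x y < \<rho>" "0 < t" "t < \<rho>" for y t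
    using desc0 that by (simp add: \<rho>_def)
  define \<tau> where "\<tau> = \<rho> / (2 * (1 + norm v))"
  have den: "1 + norm v > 0" by (simp add: add_pos_nonneg)
  have \<tau>: "0 < \<tau>" "\<tau> + \<tau> * norm v = \<rho> / 2"
  proof -
    show "0 < \<tau>" using \<open>\<rho> > 0\<close> den by (simp add: \<tau>_def)
    have "\<tau> * (1 + norm v) = \<rho> / 2"
    proof -
      have "\<rho> / (2 * c) * c = \<rho> / 2" if "c > 0" for c using that by simp
      from this[OF den] show ?thesis unfolding \<tau>_def .
    qed
    then show "\<tau> + \<tau> * norm v = \<rho> / 2" by (simp add: algebra_simps)
  qed
  have "\<tau> * norm v \<ge> 0" using \<tau> by simp
  define w where "w = x + \<tau> *\<^sub>R v"
  have "h w < h x" unfolding w_def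
  proof (rule desc)
    show "\<tau> < \<rho>" using \<tau> \<open>\<rho> > 0\<close> \<open>\<tau> * norm v \<ge> 0\<close> by linarith
  qed (use \<tau> \<open>\<rho> > 0\<close> in auto)
  have "\<tau> * norm v < \<rho>" using \<tau> \<open>\<rho> > 0\<close> by linarith
  then have "w \<in> ball x \<rho>" using \<tau> by (simp add: w_def dist_norm)
  have "open {u \<in> U. h u < h x}"
    using continuous_open_preimage[OF cont \<open>open U\<close>, of "{..<h x}"] by (simp add: Collect_conj_eq vimage_def)
  moreover have "w \<in> {u \<in> U. h u < h x}"
    using \<open>h w < h x\<close> \<open>w \<in> ball x \<rho>\<close> \<open>ball x \<rho> \<subseteq> U\<close> by auto
  ultimately obtain \<sigma>0 where "\<sigma>0 > 0" and \<sigma>0: "ball w \<sigma>0 \<subseteq> {u \<in> U. h u < h x}"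
    using open_contains_ball by blast
  define \<sigma> where "\<sigma> = min \<sigma>0 (\<rho> / 4)"
  have to_w: "connected_component {u \<in> U. h u < h x} y w" if y: "y \<in> ball x \<sigma>" "h y < h x" for y
  proof -
    have "closed_segment y (y + \<tau> *\<^sub>R v) \<subseteq> {u \<in> U. h u < h x}"
    proof
      fix z assume "z \<in> closed_segment y (y + \<tau> *\<^sub>R v)"
      then obtain s where s: "0 \<le> s" "s \<le> 1" "z = y + (s * \<tau>) *\<^sub>R v"
        by (auto simp: closed_segment_def algebra_simps)
      have s\<tau>: "s * \<tau> \<le> \<tau>" "0 \<le> s * \<tau>" using s \<tau> by (auto simp: mult_left_le_one_le)
      have "norm (z - x) \<le> norm (y - x) + (s * \<tau>) * norm v"
        using norm_triangle_ineq[of "y - x" "(s * \<tau>) *\<^sub>R v"] s s\<tau> by (simp add: algebra_simps)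
      also have "(s * \<tau>) * norm v \<le> \<tau> * norm v" using s\<tau> by (intro mult_right_mono) auto
      finally have "dist x z < \<rho>"
        using y \<tau> \<open>\<rho> > 0\<close> by (auto simp: \<sigma>_def dist_norm norm_minus_commute)
      moreover have "h z \<le> h y"
      proof (cases "s = 0")
        case False
        then have "0 < s * \<tau>" using s \<tau> by simp
        moreover have "s * \<tau> < \<rho>" using s\<tau> \<tau> \<open>\<tau> * norm v \<ge> 0\<close> \<open>\<rho> > 0\<close> by linarith
        moreover have "dist x y < \<rho>" using y \<open>\<rho> > 0\<close> by (auto simp: \<sigma>_def)
        ultimately show ?thesis using desc s by (simp add: less_imp_le)
      qed (use s in simp)
      ultimately show "z \<in> {u \<in> U. h u < h x}" using y \<open>ball x \<rho> \<subseteq> U\<close> by auto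
    qed
    then have "connected_component {u \<in> U. h u < h x} y (y + \<tau> *\<^sub>R v)"
      by (intro connected_componentI[of "closed_segment y (y + \<tau> *\<^sub>R v)"]) auto
    moreover have "connected_component {u \<in> U. h u < h x} (y + \<tau> *\<^sub>R v) w"
      using y \<open>\<sigma>0 > 0\<close> by (intro connected_componentI[OF _ \<sigma>0]) (auto simp: w_def \<sigma>_def)
    ultimately show ?thesis by (rule connected_component_trans)
  qed
  show thesis
  proof
    show "\<sigma> > 0" using \<open>\<sigma>0 > 0\<close> \<open>\<rho> > 0\<close> by (simp add: \<sigma>_def)
    show "connected_component {u \<in> U. h u < h x} y z"
      if "y \<in> ball x \<sigma>" "z \<in> ball x \<sigma>" "h y < h x" "h z < h x" for y z
      using connected_component_trans[OF to_w[OF that(1,3)] connected_component_sym[OF to_w[OF that(2,4)]]] .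
  qed
qed

lemma common_descent_point_nearby:
  assumes "common_descent_direction h k x" and "\<sigma> > 0"
  obtains y where "dist x y < \<sigma>" "h y < h x" "k y < k x"
proof -
  obtain v \<rho> where "\<rho> > 0"
    and desc: "\<And>t. 0 < t \<Longrightarrow> t < \<rho> \<Longrightarrow> h (x + t *\<^sub>R v) < h x \<and> k (x + t *\<^sub>R v) < k x"
    using assms(1) unfolding common_descent_direction_def by (metis dist_self)
  define t where "t = min (\<rho> / 2) (\<sigma> / (2 * (1 + norm v)))"
  have den: "1 + norm v > 0" by (simp add: add_pos_nonneg)
  have "0 < t" "t < \<rho>" using \<open>\<rho> > 0\<close> \<open>\<sigma> > 0\<close> den by (auto simp: t_def)
  have "t * (1 + norm v) \<le> \<sigma> / (2 * (1 + norm v)) * (1 + norm v)"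
    using den by (intro mult_right_mono) (auto simp: t_def)
  also have "\<dots> = \<sigma> / 2" using den by (simp add: field_simps)
  finally have "t * norm v < \<sigma>" using \<open>0 < t\<close> \<open>\<sigma> > 0\<close> by (simp add: algebra_simps)
  then show thesis
    using that[of "x + t *\<^sub>R v"] desc[of t] \<open>0 < t\<close> \<open>t < \<rho>\<close> by (simp add: dist_norm)
qed

text \<open>
  For each level \<open>s\<close> let \<open>C s\<close> be the component of \<open>a\<close> in the sublevel set \<open>{h < s}\<close>, and call the level
  admissible if \<open>C s\<close> has no point other than \<open>a\<close> with \<open>k \<le> 0\<close>. Low levels are admissible because \<open>a\<close>
  is a strict minimum, and \<open>d\<close> is not because of \<open>e\<close>. At the supremum \<open>s\<close> of the admissible levels
  there must be a point without common descent direction: otherwise the points on the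
  boundary of \<open>C s\<close>, all on level \<open>s\<close>, attach to no other component, and \<open>C s\<close> cannot grow
  suddenly when the level is raised.

  The second function \<open>k\<close> makes the lemma usable on a bounded set. At levels up to \<open>d\<close>, a
  component can leave the compact set \<open>K\<close> only at points with \<open>k \<le> 0\<close>, so before it has reached
  the target it stays away from the boundary of \<open>U\<close>. In applications \<open>h\<close> is \<open>k\<close> plus a penalty,
  possibly \<open>0\<close>.
\<close>

lemma mountain_pass:
  fixes h k :: "'a::real_normed_vector \<Rightarrow> real"
  assumes "open U" and "compact K" and "K \<subseteq> U" and "a \<in> interior K"
    and cont_h: "continuous_on U h" and cont_k: "continuous_on U k"
    and "h a = 0" and "k a = 0"
    and strict_min: "\<forall>\<^sub>F x in at a. 0 < h x \<and> 0 < k x"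
    and trap: "\<And>x. x \<in> U - K \<Longrightarrow> k x \<le> 0 \<or> d \<le> h x"
    and reach: "connected_component {x \<in> U. h x < d} a e" and "e \<noteq> a" and "k e \<le> 0"
  shows "\<exists>x\<in>K. 0 < h x \<and> h x < d \<and> \<not> common_descent_direction h k x"
proof (rule ccontr)
  assume "\<not> ?thesis"
  then have regular: "common_descent_direction h k x" if "x \<in> K" "0 < h x" "h x < d" for x
    using that by blast
  define A where "A = {x \<in> U. x \<noteq> a \<and> k x \<le> 0}"
  define L where "L s = {x \<in> U. h x < s}" for s
  define C where "C s = connected_component_set (L s) a" for s
  define D where "D = {s. 0 < s \<and> s \<le> d \<and> C s \<inter> A = {}}"
  have "a \<in> K" using \<open>a \<in> interior K\<close> interior_subset by blast
  then have "a \<in> U" using \<open>K \<subseteq> U\<close> by blast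
  have open_L: "open (L s)" for s
    using continuous_open_preimage[OF cont_h \<open>open U\<close>, of "{..<s}"]
    by (simp add: L_def Collect_conj_eq vimage_def)
  have C_sub: "C s \<subseteq> L s" for s unfolding C_def by (rule connected_component_subset)
  have C_conn: "connected (C s)" for s unfolding C_def by (rule connected_connected_component)
  have C_mono: "C s \<subseteq> C t" if "s \<le> t" for s t
    unfolding C_def using that by (intro connected_component_mono) (auto simp: L_def)
  have a_C: "a \<in> C s" if "0 < s" for s
    using that \<open>a \<in> U\<close> \<open>h a = 0\<close> by (auto simp: C_def L_def)
  have "e \<in> C d" using reach by (simp add: C_def L_def)
  then have "h a < d" and "e \<in> U"
    using connected_component_in[OF reach] by auto
  then have "d > 0" "e \<in> A" using \<open>h a = 0\<close> \<open>e \<noteq> a\<close> \<open>k e \<le> 0\<close> by (auto simp: A_def)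
  have d_notin: "d \<notin> D" using \<open>e \<in> C d\<close> \<open>e \<in> A\<close> by (auto simp: D_def)
  \<comment> \<open>Low levels are admissible: a small sphere around \<open>a\<close>, on which \<open>h\<close> has a positive minimum,
      encloses the component.\<close>
  obtain m where "m \<in> D"
  proof -
    obtain \<rho>1 where \<rho>1: "\<rho>1 > 0" "\<And>x. x \<noteq> a \<Longrightarrow> dist x a < \<rho>1 \<Longrightarrow> 0 < h x \<and> 0 < k x"
      using strict_min unfolding eventually_at by auto
    obtain \<rho>2 where \<rho>2: "\<rho>2 > 0" "ball a \<rho>2 \<subseteq> K"
      using \<open>a \<in> interior K\<close> mem_interior by blast
    define \<rho> where "\<rho> = min \<rho>1 \<rho>2 / 2"
    have \<rho>: "\<rho> > 0" "\<rho> < \<rho>1" "\<rho> < \<rho>2" using \<rho>1(1) \<rho>2(1) by (auto simp: \<rho>_def min_def)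
    have "sphere a \<rho> \<subseteq> K" using \<rho>2 \<rho> by (auto simp: subset_iff)
    moreover have "closed (sphere a \<rho>)"
      unfolding sphere_def by (intro closed_Collect_eq continuous_intros)
    ultimately have "compact (sphere a \<rho>)"
      using compact_Int_closed[OF \<open>compact K\<close>] by (metis Int_absorb1)
    moreover have "continuous_on (sphere a \<rho>) h"
      using cont_h continuous_on_subset \<open>sphere a \<rho> \<subseteq> K\<close> \<open>K \<subseteq> U\<close> by blast
    moreover have "0 < h x" if "x \<in> sphere a \<rho>" for x
      using \<rho>1(2)[of x] \<rho> that by (auto simp: dist_commute)
    ultimately obtain c where "c > 0" and c: "\<And>x. x \<in> sphere a \<rho> \<Longrightarrow> c \<le> h x"
      using positive_on_compact by blast
    define m where "m = min c d"
    have "m > 0" using \<open>c > 0\<close> \<open>d > 0\<close> by (simp add: m_def)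
    have "C m \<subseteq> ball a \<rho>"
    proof (rule ccontr)
      assume "\<not> C m \<subseteq> ball a \<rho>"
      then obtain y where y: "y \<in> C m" "\<rho> \<le> dist a y" by force
      have "connected (dist a ` C m)"
        by (intro connected_continuous_image C_conn continuous_intros)
      moreover have "dist a a \<in> dist a ` C m" "dist a y \<in> dist a ` C m"
        using y a_C[OF \<open>m > 0\<close>] by blast+
      ultimately have "\<rho> \<in> dist a ` C m"
        using connected_contains_Icc[of "dist a ` C m" "dist a a" "dist a y"] y(2) \<rho>(1) by auto
      then obtain x where "x \<in> C m" "x \<in> sphere a \<rho>" by auto
      then show False using c[of x] C_sub[of m] by (auto simp: L_def m_def)
    qed
    then have "C m \<inter> A = {}"
      using \<rho>1(2) \<rho>(2) by (force simp: A_def dist_commute)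
    with \<open>m > 0\<close> have "m \<in> D" by (auto simp: D_def m_def)
    then show thesis by (rule that)
  qed
  define s where "s = Sup D"
  have bdd: "bdd_above D" by (auto simp: D_def bdd_above_def)
  have "s > 0" using \<open>m \<in> D\<close> cSup_upper[OF \<open>m \<in> D\<close> bdd] by (auto simp: D_def s_def)
  have "s \<le> d" unfolding s_def using \<open>m \<in> D\<close> by (intro cSup_least) (auto simp: D_def)
  \<comment> \<open>The supremum is admissible: a path inside \<open>L s\<close> stays below some level \<open>t\<close> of \<open>D\<close>.\<close>
  have "C s \<inter> A = {}"
  proof (rule ccontr)
    assume "C s \<inter> A \<noteq> {}"
    then obtain z where z: "z \<in> C s" "z \<in> A" by blast
    then have "path_component (L s) a z"
      using open_path_connected_component[OF open_L] by (simp add: C_def)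
    then obtain \<gamma> where \<gamma>: "path \<gamma>" "path_image \<gamma> \<subseteq> L s" "pathstart \<gamma> = a" "pathfinish \<gamma> = z"
      unfolding path_component_def by blast
    then have "path_image \<gamma> \<subseteq> U" by (auto simp: L_def)
    then have "continuous_on (path_image \<gamma>) h" using cont_h continuous_on_subset by blast
    then obtain y where y: "y \<in> path_image \<gamma>" "\<And>x. x \<in> path_image \<gamma> \<Longrightarrow> h x \<le> h y"
      using continuous_attains_sup[OF compact_path_image[OF \<gamma>(1)] path_image_nonempty] by blast
    then have "h y < s" using \<gamma>(2) by (auto simp: L_def)
    then obtain t where t: "t \<in> D" "h y < t"
      unfolding s_def using less_cSup_iff[OF _ bdd] \<open>m \<in> D\<close> by blast
    have "path_image \<gamma> \<subseteq> L t" using y t \<gamma>(2) by (fastforce simp: L_def)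
    moreover have "connected (path_image \<gamma>)" using \<gamma>(1) by (rule connected_path_image)
    ultimately have "z \<in> C t"
      using \<gamma>(3,4) pathstart_in_path_image pathfinish_in_path_image
      by (auto simp: C_def intro!: connected_componentI)
    then show False using t z by (auto simp: D_def)
  qed
  with \<open>s > 0\<close> \<open>s \<le> d\<close> have "s \<in> D" by (simp add: D_def)
  with d_notin \<open>s \<le> d\<close> have "s < d" by (cases "s = d") auto
  have C_K: "C s \<subseteq> K"
  proof
    fix x assume x: "x \<in> C s"
    show "x \<in> K"
    proof (rule ccontr)
      assume "x \<notin> K"
      moreover have "x \<in> U" "h x < s" using x C_sub by (auto simp: L_def)
      ultimately show False
        using trap[of x] \<open>s < d\<close> x \<open>C s \<inter> A = {}\<close> \<open>a \<in> K\<close> by (auto simp: A_def)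
    qed
  qed
  define Q where "Q = closure (C s)"
  have "Q \<subseteq> K" unfolding Q_def using C_K \<open>compact K\<close> by (intro closure_minimal compact_imp_closed)
  then have "compact Q"
    using \<open>compact K\<close> by (metis Int_absorb1 Q_def closed_closure compact_Int_closed)
  have "C s \<subseteq> Q" unfolding Q_def by (rule closure_subset)
  have C_absorb: "y \<in> C s" if "z \<in> C s" "connected_component (L s) z y" for y z
    using that connected_component_trans unfolding C_def by fastforce
  \<comment> \<open>\<open>G\<close> collects the points at which \<open>C s\<close> sees no other component and no target point; its
      interior is a neighborhood of the closure of \<open>C s\<close>.\<close>
  define G where "G = {y \<in> U. (h y < s \<longrightarrow> y \<in> C s) \<and> (y = a \<or> 0 < k y)}"
  have "x \<in> interior G" if x: "x \<in> Q" for x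
  proof -
    have "x \<in> U" using x \<open>Q \<subseteq> K\<close> \<open>K \<subseteq> U\<close> by blast
    have approx: "\<exists>y\<in>C s. dist x y < \<tau>" if "\<tau> > 0" for \<tau>
      using x that unfolding Q_def closure_approachable by (metis dist_commute)
    obtain \<sigma>1 where \<sigma>1: "\<sigma>1 > 0" "\<And>y. y \<in> ball x \<sigma>1 \<Longrightarrow> h y < s \<Longrightarrow> y \<in> C s"
      and kx: "x = a \<or> 0 < k x"
    proof (cases "h x < s")
      case True
      then have "x \<in> L s" using \<open>x \<in> U\<close> by (simp add: L_def)
      then obtain \<sigma> where \<sigma>: "\<sigma> > 0" "ball x \<sigma> \<subseteq> L s" using open_L open_contains_ball by blast
      obtain z where z: "z \<in> C s" "z \<in> ball x \<sigma>" using approx[OF \<sigma>(1)] by auto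
      have in_C: "y \<in> C s" if "y \<in> ball x \<sigma>" for y
        using z(1) by (rule C_absorb) (use that z(2) \<sigma>(2) in \<open>auto intro!: connected_componentI[of "ball x \<sigma>"]\<close>)
      then have "x \<in> C s" using \<sigma> by simp
      then have "x = a \<or> 0 < k x"
        using \<open>C s \<inter> A = {}\<close> \<open>x \<in> U\<close> by (auto simp: A_def)
      then show thesis using that[of \<sigma>] \<sigma>(1) in_C by blast
    next
      case False
      have "closure (C s) \<subseteq> {y \<in> K. h y \<le> s}"
      proof (rule closure_minimal)
        show "C s \<subseteq> {y \<in> K. h y \<le> s}" using C_K C_sub by (force simp: L_def)
        show "closed {y \<in> K. h y \<le> s}"
          using continuous_closed_preimage[OF continuous_on_subset[OF cont_h \<open>K \<subseteq> U\<close>]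
              compact_imp_closed[OF \<open>compact K\<close>], of "{..s}"]
          by (simp add: Collect_conj_eq vimage_def)
      qed
      then have "h x = s" using x False by (auto simp: Q_def)
      then have cdd: "common_descent_direction h k x"
        using regular[of x] x \<open>Q \<subseteq> K\<close> \<open>s > 0\<close> \<open>s < d\<close> by auto
      obtain \<sigma> where \<sigma>: "\<sigma> > 0" "\<And>y z. y \<in> ball x \<sigma> \<Longrightarrow> z \<in> ball x \<sigma> \<Longrightarrow> h y < s \<Longrightarrow> h z < s \<Longrightarrow>
           connected_component (L s) y z"
        using sublevel_connected_near_descent_point[OF \<open>open U\<close> \<open>x \<in> U\<close> cont_h cdd]
        unfolding \<open>h x = s\<close> L_def by blast
      obtain z where z: "z \<in> C s" "z \<in> ball x \<sigma>" using approx[OF \<sigma>(1)] by auto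
      have in_C: "y \<in> C s" if "y \<in> ball x \<sigma>" "h y < s" for y
      proof (rule C_absorb[OF z(1)])
        have "h z < s" using z(1) C_sub by (auto simp: L_def)
        then show "connected_component (L s) z y" using \<sigma>(2)[OF z(2) that(1)] that(2) by blast
      qed
      \<comment> \<open>If \<open>k x\<close> were \<open>0\<close>, going down in \<open>h\<close> and \<open>k\<close> together would lead into \<open>C s\<close> at a target point.\<close>
      obtain y where y: "dist x y < \<sigma>" "h y < h x" "k y < k x"
        using common_descent_point_nearby[OF cdd \<sigma>(1)] .
      then have "y \<in> C s" using in_C \<open>h x = s\<close> by auto
      then have "y = a \<or> 0 < k y" using \<open>C s \<inter> A = {}\<close> C_sub by (force simp: A_def L_def)
      then have "0 < k x" using y \<open>k a = 0\<close> by auto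
      then show thesis using that[of \<sigma>] \<sigma>(1) in_C by blast
    qed
    obtain \<sigma>2 where \<sigma>2: "\<sigma>2 > 0" "ball x \<sigma>2 \<subseteq> U"
      using \<open>open U\<close> \<open>x \<in> U\<close> open_contains_ball by blast
    have "\<exists>\<sigma>3>0. \<forall>y\<in>ball x \<sigma>3. y = a \<or> 0 < k y"
    proof (cases "x = a")
      case True
      obtain \<beta> where \<beta>: "\<beta> > 0" "\<And>y. y \<noteq> a \<Longrightarrow> dist y a < \<beta> \<Longrightarrow> 0 < k y"
        using strict_min unfolding eventually_at by auto
      have "y = a \<or> 0 < k y" if "y \<in> ball x \<beta>" for y
        using \<beta>(2)[of y] that True by (cases "y = a") (auto simp: dist_commute)
      with \<beta>(1) show ?thesis by blast
    next
      case False
      then have "0 < k x" using kx by simp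
      have "open (U \<inter> k -` {0<..})" using continuous_open_preimage[OF cont_k \<open>open U\<close>] by simp
      moreover have "x \<in> U \<inter> k -` {0<..}" using \<open>x \<in> U\<close> \<open>0 < k x\<close> by simp
      ultimately obtain \<sigma>3 where "\<sigma>3 > 0" "ball x \<sigma>3 \<subseteq> U \<inter> k -` {0<..}"
        using open_contains_ball by blast
      then show ?thesis by blast
    qed
    then obtain \<sigma>3 where \<sigma>3: "\<sigma>3 > 0" "\<And>y. y \<in> ball x \<sigma>3 \<Longrightarrow> y = a \<or> 0 < k y" by blast
    define \<sigma> where "\<sigma> = min \<sigma>1 (min \<sigma>2 \<sigma>3)"
    have "\<sigma> > 0" using \<sigma>1(1) \<sigma>2(1) \<sigma>3(1) by (simp add: \<sigma>_def)
    moreover have "ball x \<sigma> \<subseteq> U" using \<sigma>2 by (auto simp: \<sigma>_def)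
    ultimately have "ball x \<sigma> \<subseteq> G" using \<sigma>1(2) \<sigma>3(2) by (force simp: \<sigma>_def G_def)
    with \<open>\<sigma> > 0\<close> show ?thesis using mem_interior by blast
  qed
  define N where "N = interior G"
  have N: "open N" "Q \<subseteq> N"
    using \<open>\<And>x. x \<in> Q \<Longrightarrow> x \<in> interior G\<close> by (auto simp: N_def)
  have N_C: "y \<in> C s" if "y \<in> N" "h y < s" for y
    using that interior_subset[of G] by (auto simp: N_def G_def)
  have N_k: "y = a \<or> 0 < k y" if "y \<in> N" for y
    using that interior_subset[of G] by (auto simp: N_def G_def)
  obtain r where "r > 0" and r: "(\<Union>x\<in>Q. cball x r) \<subseteq> N"
    using compact_subset_open_imp_cball_epsilon_subset[OF \<open>compact Q\<close> N] .
  have "a \<in> Q" using a_C[OF \<open>s > 0\<close>] \<open>C s \<subseteq> Q\<close> by blast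
  have near_N: "y \<in> N" if "infdist y Q \<le> r" for y
  proof -
    have "continuous_on Q (dist y)" by (intro continuous_intros)
    then obtain x where x: "x \<in> Q" "\<forall>z\<in>Q. dist y x \<le> dist y z"
      using continuous_attains_inf[OF \<open>compact Q\<close>, of "dist y"] \<open>a \<in> Q\<close> by blast
    then have "dist y x \<le> infdist y Q"
      unfolding infdist_def by (auto intro!: cINF_greatest)
    then show ?thesis using that r x by (force simp: dist_commute)
  qed
  define R where "R = {y \<in> K. infdist y Q = r}"
  \<comment> \<open>A shell around the closure of \<open>C s\<close> lies strictly above level \<open>s\<close>, so that the component
      cannot cross it at a slightly higher level \<open>t\<close>.\<close>
  have hR: "s < h y" if "y \<in> K" "infdist y Q = r" for y
  proof (rule ccontr)
    assume "\<not> s < h y"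
    have "y \<in> N" using near_N that by simp
    have "y \<notin> Q" using that \<open>r > 0\<close> by auto
    then have "h y = s" using N_C[OF \<open>y \<in> N\<close>] \<open>\<not> s < h y\<close> \<open>C s \<subseteq> Q\<close> by force
    then have cdd: "common_descent_direction h k y" using regular that \<open>s > 0\<close> \<open>s < d\<close> by auto
    have "y \<in> closure (C s)"
      unfolding closure_approachable
    proof (intro allI impI)
      fix \<tau> :: real assume "\<tau> > 0"
      obtain \<beta> where "\<beta> > 0" "ball y \<beta> \<subseteq> N" using \<open>y \<in> N\<close> N(1) open_contains_ball by blast
      obtain z where z: "dist y z < min \<tau> \<beta>" "h z < h y"
        using common_descent_point_nearby[OF cdd, of "min \<tau> \<beta>"] \<open>\<tau> > 0\<close> \<open>\<beta> > 0\<close>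
        by (metis min_less_iff_conj)
      then have "z \<in> C s" using N_C[of z] \<open>ball y \<beta> \<subseteq> N\<close> \<open>h y = s\<close> by auto
      then show "\<exists>z\<in>C s. dist z y < \<tau>" using z by (auto simp: dist_commute)
    qed
    then show False using \<open>y \<notin> Q\<close> by (simp add: Q_def)
  qed
  have "R = K \<inter> {y. infdist y Q = r}" by (auto simp: R_def)
  moreover have "closed {y. infdist y Q = r}"
    by (intro closed_Collect_eq continuous_intros)
  ultimately have "compact R" using \<open>compact K\<close> by (simp add: compact_Int_closed)
  moreover have "R \<subseteq> U" using \<open>K \<subseteq> U\<close> by (auto simp: R_def)
  then have "continuous_on R (\<lambda>y. h y - s)"
    using continuous_on_subset[OF cont_h] by (intro continuous_intros)
  moreover have "0 < h y - s" if "y \<in> R" for y using hR[of y] that by (simp add: R_def)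
  ultimately obtain c where c: "c > 0" "\<And>y. y \<in> R \<Longrightarrow> c \<le> h y - s"
    using positive_on_compact[of R "\<lambda>y. h y - s"] by blast
  define t0 where "t0 = s + c"
  have t0: "s < t0" "\<And>y. y \<in> R \<Longrightarrow> t0 \<le> h y" using c by (force simp: t0_def)+
  define t where "t = min t0 d"
  have "s < t" "t \<le> d" using t0(1) \<open>s < d\<close> by (auto simp: t_def)
  have inner: "infdist y Q < r" if "y \<in> C t" for y
  proof (rule ccontr)
    assume "\<not> infdist y Q < r"
    moreover have "infdist a Q = 0" using \<open>a \<in> Q\<close> by simp
    moreover have "connected ((\<lambda>y. infdist y Q) ` C t)"
      by (intro connected_continuous_image C_conn continuous_intros)
    moreover have "infdist a Q \<in> (\<lambda>y. infdist y Q) ` C t" "infdist y Q \<in> (\<lambda>y. infdist y Q) ` C t"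
      using that a_C[of t] \<open>s > 0\<close> \<open>s < t\<close> by auto
    ultimately have "r \<in> (\<lambda>y. infdist y Q) ` C t"
      using \<open>r > 0\<close> connected_contains_Icc[of "(\<lambda>y. infdist y Q) ` C t" "infdist a Q" "infdist y Q"]
      by auto
    then obtain z where z: "z \<in> C t" "infdist z Q = r" by auto
    then have "z \<in> U" "h z < t" using C_sub by (auto simp: L_def)
    then have "z \<notin> K" using t0(2)[of z] z by (auto simp: R_def t_def)
    moreover have "z = a \<or> 0 < k z" using N_k near_N z by simp
    ultimately show False using trap[of z] \<open>z \<in> U\<close> \<open>h z < t\<close> \<open>t \<le> d\<close> \<open>a \<in> K\<close> by auto
  qed
  have "C t \<inter> A = {}"
    using inner near_N N_k by (force simp: A_def)
  then have "t \<in> D" using \<open>s > 0\<close> \<open>s < t\<close> \<open>t \<le> d\<close> by (simp add: D_def)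
  then have "t \<le> s" unfolding s_def using bdd by (intro cSup_upper)
  then show False using \<open>s < t\<close> by simp
qed

section \<open>Critical points and local extrema\<close>

lemma critical_points_uminus [simp]: "critical_points U (\<lambda>u. - g u) = critical_points U g"
  using has_derivative_minus[of g "\<lambda>_. 0"] has_derivative_minus[of "\<lambda>u. - g u" "\<lambda>_. 0"]
  by (auto simp: critical_points_def)

lemma isolated_critical_point_uminus [simp]:
  "isolated_critical_point U (\<lambda>u. - g u) a = isolated_critical_point U g a"
  by (simp add: isolated_critical_point_def)

lemma extremum_uminus [simp]:
  "local_minimizer U (\<lambda>u. - g u) a = local_maximizer U g a"
  "local_maximizer U (\<lambda>u. - g u) a = local_minimizer U g a"
  "strict_local_minimizer U (\<lambda>u. - g u) a = strict_local_maximizer U g a"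
  by (simp_all add: local_minimizer_def local_maximizer_def
      strict_local_minimizer_def strict_local_maximizer_def)

lemma local_minimizer_iff_open:
  assumes "open U"
  shows "local_minimizer U g a \<longleftrightarrow> a \<in> U \<and> (\<forall>\<^sub>F x in at a. g a \<le> g x)"
  using at_within_open[OF _ assms] by (auto simp: local_minimizer_def)

lemma strict_local_minimizer_iff_open:
  assumes "open U"
  shows "strict_local_minimizer U g a \<longleftrightarrow> a \<in> U \<and> (\<forall>\<^sub>F x in at a. g a < g x)"
  using at_within_open[OF _ assms] by (auto simp: strict_local_minimizer_def)

lemma critical_point_if_minimum_on_open:
  assumes "x \<in> V" "open V" "V \<subseteq> U" "g differentiable (at x)" "\<And>y. y \<in> V \<Longrightarrow> g x \<le> g y"
  shows "x \<in> critical_points U g"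
proof -
  obtain D where D: "(g has_derivative D) (at x)" using assms(4) unfolding differentiable_def by blast
  then have "D = (\<lambda>_. 0)"
    using differential_zero_maxmin[OF assms(1,2) D] assms(5) by blast
  with D assms(1,3) show ?thesis by (auto simp: critical_points_def)
qed

text \<open>
  A nearby point with the same value would be a local minimum as well, hence another critical
  point.
\<close>

lemma isolated_local_minimizer_strict:
  fixes g :: "'a::real_normed_vector \<Rightarrow> real"
  assumes "open U" and min: "local_minimizer U g a"
    and diff: "\<And>x. x \<in> U \<Longrightarrow> g differentiable (at x)"
    and iso: "\<forall>\<^sub>F x in at a. x \<notin> critical_points U g"
  shows "\<forall>\<^sub>F x in at a. g a < g x"
proof -
  have "a \<in> U" using min by (simp add: local_minimizer_def)
  then have "\<forall>\<^sub>F x in at a. g a \<le> g x"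
    using min \<open>open U\<close> by (simp add: local_minimizer_iff_open)
  then have "\<forall>\<^sub>F x in nhds a. g a \<le> g x"
    by (auto simp: eventually_at_filter elim: eventually_mono)
  then have "\<forall>\<^sub>F x in nhds a. x \<in> U \<and> g a \<le> g x"
    using eventually_nhds_in_open[OF \<open>open U\<close> \<open>a \<in> U\<close>] by eventually_elim auto
  then obtain V where V: "open V" "a \<in> V" "\<And>x. x \<in> V \<Longrightarrow> x \<in> U \<and> g a \<le> g x"
    unfolding eventually_nhds by blast
  have "\<forall>\<^sub>F x in at a. x \<in> V"
    using V by (simp add: eventually_at_in_open')
  with iso show ?thesis
  proof eventually_elim
    case (elim x)
    show ?case
    proof (rule ccontr)
      assume "\<not> g a < g x"
      then have "g x \<le> g y" if "y \<in> V" for y using V(3)[OF that] by simp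
      then have "x \<in> critical_points U g"
        using elim V diff by (intro critical_point_if_minimum_on_open[of x V]) auto
      with elim show False by simp
    qed
  qed
qed

section \<open>Uniformity, selections and rays\<close>

lemma eventually_uniformly_close_on_compact:
  fixes \<phi> :: "'i::metric_space \<Rightarrow> 'a::metric_space \<Rightarrow> 'b::metric_space"
  assumes "compact I" "l \<in> I" "compact K" "continuous_on (I \<times> K) (\<lambda>(\<mu>, u). \<phi> \<mu> u)" "e > 0"
  shows "\<forall>\<^sub>F \<mu> in at l within I. \<forall>u\<in>K. dist (\<phi> \<mu> u) (\<phi> l u) < e"
proof -
  have "uniformly_continuous_on (I \<times> K) (\<lambda>(\<mu>, u). \<phi> \<mu> u)"
    using assms by (intro compact_uniformly_continuous compact_Times)
  then obtain d where d: "d > 0"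
    "\<And>p q. p \<in> I \<times> K \<Longrightarrow> q \<in> I \<times> K \<Longrightarrow> dist q p < d \<Longrightarrow>
        dist ((\<lambda>(\<mu>, u). \<phi> \<mu> u) q) ((\<lambda>(\<mu>, u). \<phi> \<mu> u) p) < e"
    using \<open>e > 0\<close> unfolding uniformly_continuous_on_def by blast
  have "dist (\<phi> \<mu> u) (\<phi> l u) < e" if "\<mu> \<in> I" "dist \<mu> l < d" "u \<in> K" for \<mu> u
    using d(2)[of "(l, u)" "(\<mu>, u)"] that \<open>l \<in> I\<close> by (simp add: dist_Pair_Pair)
  with d(1) show ?thesis unfolding eventually_at by blast
qed

text \<open>
  Choose in \<open>Z \<mu>\<close> an element whose norm exceeds the infimum by less than \<open>\<bar>\<mu> - l\<bar>\<close>; the infimum itself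
  need not be attained.
\<close>

lemma selection_tending_to_zero:
  fixes Z :: "real \<Rightarrow> 'a::real_normed_vector set"
  assumes small: "\<And>r. r > 0 \<Longrightarrow> \<forall>\<^sub>F \<mu> in at l within I. \<exists>u\<in>Z \<mu>. norm u < r"
  shows "\<exists>u. (\<forall>\<^sub>F \<mu> in at l within I. u \<mu> \<in> Z \<mu>) \<and> (u \<longlongrightarrow> 0) (at l within I)"
proof -
  define u where "u \<mu> = (SOME u. u \<in> Z \<mu> \<and> norm u < Inf (norm ` Z \<mu>) + \<bar>\<mu> - l\<bar>)" for \<mu>
  have u: "u \<mu> \<in> Z \<mu> \<and> norm (u \<mu>) < Inf (norm ` Z \<mu>) + \<bar>\<mu> - l\<bar>"
    if "\<mu> \<noteq> l" "Z \<mu> \<noteq> {}" for \<mu>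
  proof -
    have "Inf (norm ` Z \<mu>) < Inf (norm ` Z \<mu>) + \<bar>\<mu> - l\<bar>" using that by simp
    then have "\<exists>y\<in>norm ` Z \<mu>. y < Inf (norm ` Z \<mu>) + \<bar>\<mu> - l\<bar>"
      using that by (intro cInf_lessD) auto
    then have "\<exists>u. u \<in> Z \<mu> \<and> norm u < Inf (norm ` Z \<mu>) + \<bar>\<mu> - l\<bar>" by blast
    then show ?thesis unfolding u_def by (rule someI_ex)
  qed
  have not_l: "\<forall>\<^sub>F \<mu> in at l within I. \<mu> \<noteq> l" by (simp add: eventually_at_filter)
  have "\<forall>\<^sub>F \<mu> in at l within I. u \<mu> \<in> Z \<mu>"
    using small[OF zero_less_one] not_l by eventually_elim (use u in blast)
  moreover have "(u \<longlongrightarrow> 0) (at l within I)"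
    unfolding tendsto_iff
  proof (intro allI impI)
    fix e :: real assume "e > 0"
    have "\<forall>\<^sub>F \<mu> in at l within I. \<bar>\<mu> - l\<bar> < e / 2"
      using \<open>e > 0\<close> by (auto simp: eventually_at dist_real_def intro!: exI[of _ "e / 2"])
    moreover have "\<forall>\<^sub>F \<mu> in at l within I. \<exists>u\<in>Z \<mu>. norm u < e / 2"
      using \<open>e > 0\<close> by (intro small) simp
    ultimately show "\<forall>\<^sub>F \<mu> in at l within I. dist (u \<mu>) 0 < e"
      using not_l
    proof eventually_elim
      case (elim \<mu>)
      then obtain w where w: "w \<in> Z \<mu>" "norm w < e / 2" by blast
      have "Inf (norm ` Z \<mu>) \<le> norm w"
        using w(1) by (intro cInf_lower) (auto intro!: bdd_belowI[of _ 0])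
      moreover have "norm (u \<mu>) < Inf (norm ` Z \<mu>) + \<bar>\<mu> - l\<bar>" using u elim(3) w(1) by blast
      ultimately show ?case using elim(1) w(2) by simp
    qed
  qed
  ultimately show ?thesis by blast
qed

text \<open>
  For independent \<open>p\<close> and \<open>a\<close>, the vectors \<open>p + n a\<close> with \<open>n\<close> a natural number span pairwise
  different rays, so a finite set cannot meet all of these rays.
\<close>

lemma ray_avoiding_finite_set:
  fixes G :: "'a::real_vector set"
  assumes "finite G" and "dim (UNIV :: 'a set) > 1"
  obtains v where "v \<noteq> 0" and "\<And>t. t > 0 \<Longrightarrow> t *\<^sub>R v \<notin> G"
proof -
  have "\<not> (UNIV :: 'a set) \<subseteq> span {}"
    using dim_le_card[of "UNIV :: 'a set" "{}"] assms(2) by auto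
  then obtain p :: 'a where "p \<noteq> 0" by auto
  have "\<not> (UNIV :: 'a set) \<subseteq> span {p}"
    using dim_le_card[of "UNIV :: 'a set" "{p}"] assms(2) by auto
  then obtain a where a: "a \<notin> span {p}" by auto
  define v where "v n = p + real n *\<^sub>R a" for n
  have v0: "v n \<noteq> 0" for n
  proof
    assume "v n = 0"
    then have "p = - (real n *\<^sub>R a)" by (simp add: v_def add_eq_0_iff2)
    moreover from this have "n \<noteq> 0" using \<open>p \<noteq> 0\<close> by auto
    ultimately have "a = (- 1 / real n) *\<^sub>R p" by simp
    with a show False by (metis span_base span_mul insertI1)
  qed
  have "\<exists>n. \<forall>t>0. t *\<^sub>R v n \<notin> G"
  proof (rule ccontr)
    assume "\<not> ?thesis"
    then obtain t where t: "\<And>n. t n > 0" "\<And>n. t n *\<^sub>R v n \<in> G" by metis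
    have "inj (\<lambda>n. t n *\<^sub>R v n)"
    proof (rule injI)
      fix n m assume "t n *\<^sub>R v n = t m *\<^sub>R v m"
      then have eq: "(t n * real n - t m * real m) *\<^sub>R a = (t m - t n) *\<^sub>R p"
        by (simp add: v_def algebra_simps)
      have "t n * real n = t m * real m"
      proof (rule ccontr)
        assume ne: "t n * real n \<noteq> t m * real m"
        then have "a = ((t m - t n) / (t n * real n - t m * real m)) *\<^sub>R p"
          using arg_cong[OF eq, of "\<lambda>x. (1 / (t n * real n - t m * real m)) *\<^sub>R x"] by simp
        with a show False by (metis span_base span_mul insertI1)
      qed
      moreover from this have "t n = t m" using eq \<open>p \<noteq> 0\<close> by simp
      ultimately show "n = m" using t(1)[of m] by simp
    qed
    then have "infinite (range (\<lambda>n. t n *\<^sub>R v n))" by (rule range_inj_infinite)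
    moreover have "range (\<lambda>n. t n *\<^sub>R v n) \<subseteq> G" using t by blast
    ultimately show False using assms(1) finite_subset by blast
  qed
  then show thesis using that v0 by blast
qed

section \<open>Families of functions of class $C^1$\<close>

text \<open>
  The assumptions here are invariant under \<open>f \<mapsto> - f\<close>, which exchanges minima and maxima; the results
  on extrema below are therefore proved for one of the two alternatives only.
\<close>

locale C1_family =
  fixes f :: "real \<Rightarrow> 'a::real_normed_vector \<Rightarrow> real" and f' :: "real \<Rightarrow> 'a \<Rightarrow> 'a \<Rightarrow>\<^sub>L real"
    and I :: "real set" and l \<epsilon> :: real
  assumes compact_cball: "compact (cball (0 :: 'a) r)"
    and nontrivial: "(UNIV :: 'a set) \<noteq> {0}"
    and compact_I: "compact I" and l_in_I: "l \<in> I" and \<epsilon>_pos: "\<epsilon> > 0"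
    and deriv: "\<mu> \<in> I \<Longrightarrow> u \<in> ball 0 \<epsilon> \<Longrightarrow> (f \<mu> has_derivative blinfun_apply (f' \<mu> u)) (at u)"
    and cont_f: "continuous_on (I \<times> ball 0 \<epsilon>) (\<lambda>(\<mu>, u). f \<mu> u)"
    and cont_f': "continuous_on (I \<times> ball 0 \<epsilon>) (\<lambda>(\<mu>, u). f' \<mu> u)"
begin

abbreviation B :: "'a set" where "B \<equiv> ball 0 \<epsilon>"

lemma C1_family_uminus: "C1_family (\<lambda>\<mu> u. - f \<mu> u) (\<lambda>\<mu> u. - f' \<mu> u) I l \<epsilon>"
proof
  show "((\<lambda>u. - f \<mu> u) has_derivative blinfun_apply (- f' \<mu> u)) (at u)" if "\<mu> \<in> I" "u \<in> B" for \<mu> u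
    using has_derivative_minus[OF deriv[OF that]] by (simp add: uminus_blinfun.rep_eq)
  show "continuous_on (I \<times> B) (\<lambda>(\<mu>, u). - f \<mu> u)"
    using continuous_on_minus[OF cont_f] by (simp add: case_prod_unfold)
  show "continuous_on (I \<times> B) (\<lambda>(\<mu>, u). - f' \<mu> u)"
    using continuous_on_minus[OF cont_f'] by (simp add: case_prod_unfold)
qed (use compact_cball nontrivial compact_I l_in_I \<epsilon>_pos in auto)

lemma mem_critical_points_iff:
  assumes "\<mu> \<in> I"
  shows "u \<in> critical_points B (f \<mu>) \<longleftrightarrow> u \<in> B \<and> f' \<mu> u = 0"
proof
  assume "u \<in> critical_points B (f \<mu>)"
  then have u: "u \<in> B" "(f \<mu> has_derivative (\<lambda>_. 0)) (at u)" by (auto simp: critical_points_def)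
  then have "blinfun_apply (f' \<mu> u) = (\<lambda>_. 0)"
    using deriv[OF assms u(1)] has_derivative_unique by blast
  with u(1) show "u \<in> B \<and> f' \<mu> u = 0" by (auto intro: blinfun_eqI)
next
  assume "u \<in> B \<and> f' \<mu> u = 0"
  then show "u \<in> critical_points B (f \<mu>)"
    using deriv[OF assms, of u] by (auto simp: critical_points_def zero_blinfun.rep_eq)
qed

lemma differentiable: "\<mu> \<in> I \<Longrightarrow> u \<in> B \<Longrightarrow> f \<mu> differentiable (at u)"
  using deriv differentiable_def by blast

lemma slice_continuous:
  assumes "\<mu> \<in> I"
  shows "continuous_on B (f \<mu>)" "continuous_on B (f' \<mu>)"
proof -
  have "continuous_on B (\<lambda>u. (\<mu>, u))" by (intro continuous_intros)
  moreover have "(\<lambda>u. (\<mu>, u)) ` B \<subseteq> I \<times> B" using assms by auto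
  ultimately show "continuous_on B (f \<mu>)" "continuous_on B (f' \<mu>)"
    using continuous_on_compose2[OF cont_f] continuous_on_compose2[OF cont_f'] by fastforce+
qed

lemma eventually_close:
  assumes "compact K" "K \<subseteq> B" "e > 0"
  shows "\<forall>\<^sub>F \<mu> in at l within I. \<forall>u\<in>K. \<bar>f \<mu> u - f l u\<bar> < e"
    and "\<forall>\<^sub>F \<mu> in at l within I. \<forall>u\<in>K. norm (f' \<mu> u - f' l u) < e"
proof -
  have "I \<times> K \<subseteq> I \<times> B" using assms by auto
  then show "\<forall>\<^sub>F \<mu> in at l within I. \<forall>u\<in>K. \<bar>f \<mu> u - f l u\<bar> < e"
    and "\<forall>\<^sub>F \<mu> in at l within I. \<forall>u\<in>K. norm (f' \<mu> u - f' l u) < e"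
    using eventually_uniformly_close_on_compact[OF compact_I l_in_I assms(1)
        continuous_on_subset[OF cont_f] assms(3)]
      eventually_uniformly_close_on_compact[OF compact_I l_in_I assms(1)
        continuous_on_subset[OF cont_f'] assms(3)]
    by (simp_all add: dist_norm)
qed

lemma compact_annulus: "compact {x :: 'a. r \<le> norm x \<and> norm x \<le> R}"
proof -
  have "closed {x :: 'a. r \<le> norm x}" by (intro closed_Collect_le continuous_intros)
  then have "compact (cball 0 R \<inter> {x :: 'a. r \<le> norm x})"
    using compact_cball by (intro compact_Int_closed)
  moreover have "cball 0 R \<inter> {x. r \<le> norm x} = {x :: 'a. r \<le> norm x \<and> norm x \<le> R}" by auto
  ultimately show ?thesis by simp
qed

lemma eventually_not_critical:
  assumes "isolated_critical_point B (f l) 0"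
  shows "\<forall>\<^sub>F x in at 0. x \<notin> critical_points B (f l)"
proof -
  obtain T where "open T" "T \<inter> critical_points B (f l) = {0}"
    using assms unfolding isolated_critical_point_def isolated_in_def by blast
  then have "\<forall>\<^sub>F x in at 0. x \<in> T - {0}"
    using eventually_at_in_open[of T 0] by auto
  then show ?thesis
    by (rule eventually_mono) (use \<open>T \<inter> critical_points B (f l) = {0}\<close> in auto)
qed

text \<open>
  Suppose that \<open>0\<close> is a local minimum of \<open>f \<mu>\<close> and its only critical point in a small ball of radius
  \<open>R\<close>. Since \<open>f \<mu>\<close> is close to \<open>f l\<close>, for which \<open>0\<close> is not a local minimum, there is a point \<open>e\<close> very near \<open>0\<close> at which \<open>f \<mu>\<close> is lower than at \<open>0\<close>,
  and the segment from \<open>0\<close> to \<open>e\<close> crosses only a very low ridge. This is a mountain pass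
  situation, but low paths might leave the ball. To exclude that, the function is penalized
  by \<open>c\<close> times the distance from the ball of radius \<open>R / 2\<close>. Here \<open>c\<close> is smaller than the norm
  of the derivative on the annulus, so the penalty creates no critical points there; and
  outside radius \<open>3 / 4 R\<close> the penalty is at least \<open>d = c R / 4\<close>, whereas the ridge is lower than \<open>d\<close>
  once \<open>e\<close> is taken close enough to \<open>0\<close>.
\<close>

proposition nontrivial_critical_point_if_minimum_lost:
  assumes iso: "isolated_critical_point B (f l) 0"
    and not_min: "\<not> local_minimizer B (f l) 0"
    and "r > 0"
  shows "\<forall>\<^sub>F \<mu> in at l within I. local_minimizer B (f \<mu>) 0 \<longrightarrow>
           (\<exists>u\<in>critical_points B (f \<mu>) - {0}. norm u < r)"
proof -
  obtain R1 where R1: "R1 > 0" "\<And>x. x \<noteq> 0 \<Longrightarrow> norm x < R1 \<Longrightarrow> x \<notin> critical_points B (f l)"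
    using eventually_not_critical[OF iso] unfolding eventually_at by auto
  define R where "R = min R1 (min r \<epsilon>) / 2"
  have R: "0 < R" "R < R1" "R < r" "R < \<epsilon>"
    using R1(1) \<open>r > 0\<close> \<epsilon>_pos by (auto simp: R_def min_def)
  then have cball_R: "cball 0 R \<subseteq> B" by auto
  define T where "T = {x :: 'a. R / 2 \<le> norm x \<and> norm x \<le> R}"
  have T_B: "T \<subseteq> B" using R by (auto simp: T_def)
  have "compact T" unfolding T_def by (rule compact_annulus)
  moreover have "continuous_on T (\<lambda>x. norm (f' l x))"
    using continuous_on_subset[OF slice_continuous(2)[OF l_in_I] T_B] by (intro continuous_intros)
  moreover have "0 < norm (f' l x)" if "x \<in> T" for x
  proof -
    have "x \<noteq> 0" "norm x < R1" "x \<in> B" using that R T_B by (auto simp: T_def)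
    then show ?thesis using R1(2) mem_critical_points_iff[OF l_in_I, of x] by auto
  qed
  ultimately obtain c0 where c0: "c0 > 0" "\<And>x. x \<in> T \<Longrightarrow> c0 \<le> norm (f' l x)"
    using positive_on_compact by blast
  define c where "c = c0 / 2"
  have "c > 0" using c0 by (simp add: c_def)
  define d where "d = c * (R / 4)"
  have "d > 0" using \<open>c > 0\<close> R by (simp add: d_def)
  have "isCont (f l) 0"
    using slice_continuous(1)[OF l_in_I] \<epsilon>_pos by (simp add: continuous_on_eq_continuous_at)
  then obtain s0 where s0: "s0 > 0" "\<And>x. norm x < s0 \<Longrightarrow> \<bar>f l x - f l 0\<bar> < d / 2"
    using \<open>d > 0\<close> unfolding continuous_at_eps_delta
    by (metis diff_zero dist_norm half_gt_zero real_norm_def)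
  define s where "s = min s0 (R / 2)"
  have s: "s > 0" "s \<le> R / 2" using s0 R by (auto simp: s_def)
  have "\<not> (\<forall>\<^sub>F x in at 0. f l 0 \<le> f l x)"
    using not_min \<epsilon>_pos by (simp add: local_minimizer_iff_open)
  then obtain e where e: "norm e < s" "f l e < f l 0" "e \<noteq> 0"
    using s unfolding eventually_at by (force simp: not_le)
  \<comment> \<open>The accuracy \<open>\<tau>\<close> is used at \<open>x\<close> and at \<open>0\<close>, so differences are known up to \<open>2 * \<tau>\<close>.\<close>
  define \<tau> where "\<tau> = min (d / 4) ((f l 0 - f l e) / 2)"
  have \<tau>: "\<tau> > 0" "\<tau> \<le> d / 4" "\<tau> \<le> (f l 0 - f l e) / 2"
    using e \<open>d > 0\<close> by (simp_all only: \<tau>_def min.cobounded1 min.cobounded2) simp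
  have "\<forall>\<^sub>F \<mu> in at l within I. \<mu> \<in> I" by (simp add: eventually_at_filter)
  with eventually_close(1)[OF compact_cball cball_R \<tau>(1)]
    eventually_close(2)[OF compact_cball cball_R \<open>c > 0\<close>]
  show ?thesis
  proof eventually_elim
    case (elim \<mu>)
    show ?case
    proof (rule impI, rule ccontr)
      assume min: "local_minimizer B (f \<mu>) 0"
        and no: "\<not> (\<exists>u\<in>critical_points B (f \<mu>) - {0}. norm u < r)"
      define g where "g x = f \<mu> x - f \<mu> 0" for x
      define p where "p x = c * max 0 (norm x - R / 2)" for x :: 'a
      define h where "h x = g x + p x" for x
      have p_lip: "c-lipschitz_on X p" for X
      proof (rule lipschitz_onI)
        fix x y :: 'a
        have "\<bar>max 0 (norm x - R / 2) - max 0 (norm y - R / 2)\<bar> \<le> norm (x - y)"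
          using norm_triangle_ineq3[of x y] by (auto simp: max_def)
        then show "dist (p x) (p y) \<le> c * dist x y"
          using \<open>c > 0\<close> by (simp add: p_def dist_norm abs_mult flip: right_diff_distrib)
      qed (use \<open>c > 0\<close> in simp)
      have noncrit: "f' \<mu> x \<noteq> 0" if "x \<noteq> 0" "norm x \<le> R" for x
        using no that R mem_critical_points_iff[OF elim(3), of x] by force
      have g_deriv: "(g has_derivative blinfun_apply (f' \<mu> x)) (at x)" if "x \<in> B" for x
        unfolding g_def using deriv[OF elim(3) that] by (auto intro!: derivative_eq_intros)
      have g_cont: "continuous_on (ball 0 R) g"
        unfolding g_def
        using continuous_on_subset[OF slice_continuous(1)[OF elim(3)] subset_ball[of R \<epsilon>]] R
        by (intro continuous_intros) auto
      have f'_cont: "continuous_on (ball 0 \<rho>) (f' \<mu>)" if "\<rho> \<le> R" for \<rho>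
        using continuous_on_subset[OF slice_continuous(2)[OF elim(3)] subset_ball[of \<rho> \<epsilon>]] that R
        by simp
      have iso_\<mu>: "\<forall>\<^sub>F x in at 0. x \<notin> critical_points B (f \<mu>)"
        using no \<open>r > 0\<close> unfolding eventually_at by (auto intro!: exI[of _ r])
      have strict: "\<forall>\<^sub>F x in at 0. f \<mu> 0 < f \<mu> x"
        using isolated_local_minimizer_strict[OF open_ball min differentiable[OF elim(3)] iso_\<mu>] .
      have p_nonneg: "p x \<ge> 0" for x using \<open>c > 0\<close> by (simp add: p_def)
      have p_zero: "p x = 0" if "norm x < R / 2" for x using that by (simp add: p_def)
      have g_close: "\<bar>g x - (f l x - f l 0)\<bar> < 2 * \<tau>" if "norm x \<le> R" for x
      proof -
        have "\<bar>f \<mu> x - f l x\<bar> < \<tau>" "\<bar>f \<mu> 0 - f l 0\<bar> < \<tau>" using elim(1) that R by auto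
        then show ?thesis by (simp add: g_def abs_if split: if_splits)
      qed
      have "\<exists>x\<in>cball 0 (3 / 4 * R). 0 < h x \<and> h x < d \<and> \<not> common_descent_direction h g x"
      proof (rule mountain_pass)
        show "(0::'a) \<in> interior (cball 0 (3 / 4 * R))"
          using R ball_subset_cball[of "0::'a" "3 / 4 * R"] by (auto intro!: interiorI[of "ball 0 (3 / 4 * R)"])
        show "continuous_on (ball 0 R) h" unfolding h_def
          using g_cont lipschitz_on_continuous_on[OF p_lip] by (intro continuous_intros)
        show "h 0 = 0" using R by (simp add: h_def g_def p_def)
        show "\<forall>\<^sub>F x in at 0. 0 < h x \<and> 0 < g x"
          using strict by eventually_elim (use p_nonneg in \<open>auto simp: h_def g_def add_pos_nonneg\<close>)
        show "g x \<le> 0 \<or> d \<le> h x" if "x \<in> ball 0 R - cball 0 (3 / 4 * R)" for x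
        proof -
          have "c * (R / 4) \<le> c * max 0 (norm x - R / 2)"
            using that \<open>c > 0\<close> by (intro mult_left_mono) auto
          then show ?thesis by (auto simp: h_def p_def d_def)
        qed
        show "connected_component {x \<in> ball 0 R. h x < d} 0 e"
        proof (rule connected_componentI)
          show "closed_segment 0 e \<subseteq> {x \<in> ball 0 R. h x < d}"
          proof
            fix x assume "x \<in> closed_segment 0 e"
            then have "norm x \<le> norm e"
              using segment_bound1[of x 0 e] by simp
            then have "norm x < s" using e by simp
            moreover from this have "\<bar>f l x - f l 0\<bar> < d / 2" using s0 by (simp add: s_def)
            ultimately show "x \<in> {x \<in> ball 0 R. h x < d}"
              using g_close[of x] p_zero[of x] \<tau> s R by (auto simp: h_def abs_if split: if_splits)
          qed
        qed auto
        show "g e \<le> 0" using g_close[of e] e \<tau> s R by (auto simp: abs_if split: if_splits)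
      qed (use R e compact_cball g_cont in \<open>auto simp: g_def\<close>)
      then obtain x where x: "norm x \<le> 3 / 4 * R" "0 < h x" "\<not> common_descent_direction h g x"
        by auto
      have "x \<noteq> 0" using x(2) R by (auto simp: h_def g_def p_def)
      have "common_descent_direction h g x"
      \<comment> \<open>The penalty vanishes in the inner ball, where any nonzero derivative suffices; in the annulus
          its Lipschitz constant \<open>c\<close> is below the norm of the derivative.\<close>
      proof (cases "norm x < R / 2")
        case True
        have "0-lipschitz_on (ball 0 (R / 2)) p"
          by (rule lipschitz_onI) (auto simp: p_zero)
        then show ?thesis unfolding h_def
          using True R \<open>x \<noteq> 0\<close> noncrit[of x] f'_cont[of "R / 2"] g_deriv
          by (intro common_descent_direction_add_small_Lipschitz[of "ball 0 (R / 2)" x g "f' \<mu>" 0]) auto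
      next
        case False
        have "2 * c \<le> norm (f' l x)" using c0(2)[of x] False x(1) R by (simp add: T_def c_def)
        moreover have "norm (f' \<mu> x - f' l x) < c" using elim(2) x(1) R by auto
        ultimately have "c < norm (f' \<mu> x)"
          using norm_triangle_ineq2[of "f' l x" "f' \<mu> x"] by (simp add: norm_minus_commute)
        then show ?thesis unfolding h_def
          using x(1) R f'_cont[of R] g_deriv p_lip
          by (intro common_descent_direction_add_small_Lipschitz[of "ball 0 R" x g "f' \<mu>" c]) auto
      qed
      with x(3) show False ..
    qed
  qed
qed

text \<open>
  If \<open>f \<mu>\<close> has infinitely many critical points in \<open>W\<close>, there are two besides \<open>0\<close>. Otherwise \<open>0\<close> is a
  strict local maximum of \<open>f \<mu>\<close>. On a small sphere, \<open>f \<mu>\<close> is larger than \<open>f \<mu> 0\<close> because \<open>0\<close> is a strict minimum of \<open>f l\<close>, whereas near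
  \<open>0\<close> it is smaller. So the minimum of \<open>f \<mu>\<close> on the ball is attained at a critical point \<open>p1\<close> different
  from \<open>0\<close>. For a second point, consider paths from \<open>0\<close> to the sphere and maximize along them the
  minimum of \<open>f \<mu>\<close>; this is the mountain pass lemma for \<open>- f \<mu>\<close>. Every path starts by descending,
  so the level is below \<open>f \<mu> 0\<close>. It is above \<open>f \<mu> p1\<close> as soon as some ray from \<open>0\<close> avoids the
  global minimum points. If these are finite in number and the dimension exceeds \<open>1\<close>, such a
  ray exists. If \<open>p1\<close> is the only one, the opposite ray will do, in any dimension; and if
  there is another one, it is itself a second critical point.
\<close>

proposition two_critical_points_if_strict_minimum_becomes_maximum:
  assumes iso: "isolated_critical_point B (f l) 0"
    and min: "local_minimizer B (f l) 0"
    and W: "W \<subseteq> B" "0 \<in> interior W"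
  shows "\<forall>\<^sub>F \<mu> in at l within I. local_maximizer B (f \<mu>) 0 \<longrightarrow>
           (\<exists>p1 p2. p1 \<noteq> p2 \<and> {p1, p2} \<subseteq> critical_points B (f \<mu>) \<inter> W - {0}) \<and>
           (finite (critical_points B (f \<mu>) \<inter> W) \<and> dim (UNIV :: 'a set) > 1 \<longrightarrow>
             (\<exists>p1 p2. p1 \<noteq> p2 \<and> {p1, p2} \<subseteq> critical_points B (f \<mu>) \<inter> W - {0} \<and>
                f \<mu> p2 > f \<mu> p1 \<and> strict_local_minimizer B (f \<mu>) p1))"
proof -
  have strict: "\<forall>\<^sub>F x in at 0. f l 0 < f l x"
    using isolated_local_minimizer_strict[OF open_ball min differentiable[OF l_in_I]
        eventually_not_critical[OF iso]] .
  obtain R1 where R1: "R1 > 0" "\<And>x. x \<noteq> 0 \<Longrightarrow> norm x < R1 \<Longrightarrow> f l 0 < f l x"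
    using strict unfolding eventually_at by auto
  obtain R2 where R2: "R2 > 0" "ball 0 R2 \<subseteq> W" using W(2) mem_interior by blast
  define R where "R = min R1 R2 / 2"
  have R: "0 < R" "R < R1" "R < R2" using R1(1) R2(1) by (auto simp: R_def min_def)
  have cball_W: "cball 0 R \<subseteq> W" using R R2 by (auto simp: subset_iff)
  then have ball_W: "ball 0 R \<subseteq> W" using ball_subset_cball by blast
  have cball_B: "cball 0 R \<subseteq> B" using cball_W W(1) by blast
  define T where "T = {x :: 'a. R / 2 \<le> norm x \<and> norm x \<le> R}"
  have "T \<subseteq> cball 0 R" by (auto simp: T_def)
  have "compact T" unfolding T_def by (rule compact_annulus)
  moreover have "continuous_on T (\<lambda>x. f l x - f l 0)"
    using continuous_on_subset[OF slice_continuous(1)[OF l_in_I], of T] \<open>T \<subseteq> cball 0 R\<close> cball_B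
    by (intro continuous_intros) auto
  moreover have "0 < f l x - f l 0" if "x \<in> T" for x
  proof -
    have "x \<noteq> 0" "norm x < R1" using that R by (auto simp: T_def)
    then show ?thesis using R1(2) by simp
  qed
  ultimately obtain b where b: "b > 0" "\<And>x. x \<in> T \<Longrightarrow> b \<le> f l x - f l 0"
    using positive_on_compact[of T "\<lambda>x. f l x - f l 0"] by blast
  then have "b / 2 > 0" by simp
  have "\<forall>\<^sub>F \<mu> in at l within I. \<mu> \<in> I" by (simp add: eventually_at_filter)
  with eventually_close(1)[OF compact_cball cball_B \<open>b / 2 > 0\<close>] show ?thesis
  proof eventually_elim
    case (elim \<mu>)
    define Z where "Z = critical_points B (f \<mu>) \<inter> W"
    have T_pos: "f \<mu> 0 < f \<mu> x" if "x \<in> T" for x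
    proof -
      have "\<bar>f \<mu> x - f l x\<bar> < b / 2" "\<bar>f \<mu> 0 - f l 0\<bar> < b / 2"
        using elim(1) that R \<open>T \<subseteq> cball 0 R\<close> by auto
      then show ?thesis using b(2)[OF that] by (simp add: abs_if split: if_splits)
    qed
    show ?case
    proof (cases "finite Z")
      case False
      then have "infinite (Z - {0})" by simp
      then obtain p1 where p1: "p1 \<in> Z - {0}" by (metis finite.emptyI ex_in_conv)
      from False have "infinite (Z - {0, p1})" by simp
      then obtain p2 where "p2 \<in> Z - {0, p1}" by (metis finite.emptyI ex_in_conv)
      with p1 have "p1 \<noteq> p2 \<and> {p1, p2} \<subseteq> critical_points B (f \<mu>) \<inter> W - {0}" by (auto simp: Z_def)
      with False show ?thesis by (auto simp: Z_def)
    next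
      case True
      have iso_Z: "\<forall>\<^sub>F x in at a. x \<notin> critical_points B (f \<mu>)" if "a \<in> ball 0 R" for a
      proof -
        have "\<forall>\<^sub>F x in at a. x \<notin> Z" using True islimpt_finite islimpt_iff_eventually by blast
        moreover have "\<forall>\<^sub>F x in at a. x \<in> ball 0 R"
          using that by (intro eventually_at_in_open') auto
        ultimately show ?thesis
          by eventually_elim (use ball_W in \<open>auto simp: Z_def\<close>)
      qed
      show ?thesis
      proof
        assume max: "local_maximizer B (f \<mu>) 0"
        have strict0: "\<forall>\<^sub>F x in at 0. f \<mu> x < f \<mu> 0"
          using isolated_local_minimizer_strict[of B "\<lambda>u. - f \<mu> u" 0] max
            differentiable[OF elim(2)] iso_Z[of 0] R by auto
        have cont: "continuous_on (cball 0 R) (f \<mu>)"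
          using continuous_on_subset[OF slice_continuous(1)[OF elim(2)] cball_B] .
        have "cball (0 :: 'a) R \<noteq> {}" using R by auto
        then obtain p1 where p1: "p1 \<in> cball 0 R" "\<And>x. x \<in> cball 0 R \<Longrightarrow> f \<mu> p1 \<le> f \<mu> x"
          using continuous_attains_inf[OF compact_cball _ cont] by blast
        have "f \<mu> p1 < f \<mu> 0"
        proof -
          obtain \<beta> where \<beta>: "\<beta> > 0" "\<And>x. x \<noteq> 0 \<Longrightarrow> norm x < \<beta> \<Longrightarrow> f \<mu> x < f \<mu> 0"
            using strict0 unfolding eventually_at by auto
          obtain w :: 'a where "w \<noteq> 0" using nontrivial by auto
          define x where "x = (min \<beta> R / 2 / norm w) *\<^sub>R w"
          have "norm x = min \<beta> R / 2" using \<open>w \<noteq> 0\<close> \<beta>(1) R by (simp add: x_def)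
          then have "norm x < \<beta>" "norm x \<le> R" "x \<noteq> 0" using \<beta>(1) R by (auto simp: min_def split: if_splits)
          then show ?thesis using \<beta>(2)[of x] p1(2)[of x] by simp
        qed
        define G where "G = {x \<in> cball 0 R. f \<mu> x = f \<mu> p1}"
        have G: "x \<in> ball 0 R \<and> x \<in> Z - {0}" if "x \<in> G" for x
        proof -
          have x: "x \<in> cball 0 R" "f \<mu> x = f \<mu> p1" using that by (auto simp: G_def)
          have "x \<notin> T" using T_pos[of x] x \<open>f \<mu> p1 < f \<mu> 0\<close> by auto
          then have "x \<in> ball 0 R" using x R by (auto simp: T_def)
          moreover have "x \<in> critical_points B (f \<mu>)"
          proof (rule critical_point_if_minimum_on_open)
            show "x \<in> ball 0 R" by fact
            show "f \<mu> differentiable at x" using differentiable[OF elim(2)] x(1) cball_B by blast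
            show "f \<mu> x \<le> f \<mu> y" if "y \<in> ball 0 R" for y using p1(2)[of y] that x(2) by auto
          qed (use cball_B in auto)
          ultimately show ?thesis using x \<open>f \<mu> p1 < f \<mu> 0\<close> cball_W by (auto simp: Z_def)
        qed
        have "p1 \<in> G" using p1 by (simp add: G_def)
        have strict1: "strict_local_minimizer B (f \<mu>) p1"
        proof -
          have "p1 \<in> ball 0 R" using G \<open>p1 \<in> G\<close> by blast
          moreover have "p1 \<in> B" using p1(1) cball_B by blast
          moreover have "\<forall>\<^sub>F x in at p1. x \<in> ball 0 R"
            using \<open>p1 \<in> ball 0 R\<close> by (intro eventually_at_in_open') auto
          then have "\<forall>\<^sub>F x in at p1. f \<mu> p1 \<le> f \<mu> x"
            by eventually_elim (use p1(2) in auto)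
          with \<open>p1 \<in> B\<close> have "local_minimizer B (f \<mu>) p1"
            by (simp add: local_minimizer_iff_open)
          ultimately show ?thesis
            using isolated_local_minimizer_strict[of B "f \<mu>" p1] differentiable[OF elim(2)] iso_Z[of p1]
            by (simp add: strict_local_minimizer_iff_open)
        qed
        have second: "\<exists>p2\<in>Z - {0}. f \<mu> p1 < f \<mu> p2"
          if v: "v \<noteq> 0" "\<And>t. t > 0 \<Longrightarrow> t *\<^sub>R v \<notin> G" for v
        proof -
          define k where "k x = f \<mu> 0 - f \<mu> x" for x
          define e where "e = (3 / 4 * R / norm v) *\<^sub>R v"
          have "norm e = 3 / 4 * R" using v(1) R by (simp add: e_def)
          have k_cont: "continuous_on (ball 0 R) k"
            unfolding k_def using continuous_on_subset[OF cont] by (intro continuous_intros) auto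
          have "\<exists>x\<in>cball 0 (3 / 4 * R). 0 < k x \<and> k x < k p1 \<and> \<not> common_descent_direction k k x"
          proof (rule mountain_pass)
            show "(0::'a) \<in> interior (cball 0 (3 / 4 * R))"
              using R ball_subset_cball[of "0::'a" "3 / 4 * R"] by (auto intro!: interiorI[of "ball 0 (3 / 4 * R)"])
            show "\<forall>\<^sub>F x in at 0. 0 < k x \<and> 0 < k x"
              using strict0 by (simp add: k_def)
            show "k x \<le> 0 \<or> k p1 \<le> k x" if "x \<in> ball 0 R - cball 0 (3 / 4 * R)" for x
              using T_pos[of x] that R by (auto simp: T_def k_def)
            show "connected_component {x \<in> ball 0 R. k x < k p1} 0 e"
            proof (rule connected_componentI)
              show "closed_segment 0 e \<subseteq> {x \<in> ball 0 R. k x < k p1}"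
              proof
                fix x assume x: "x \<in> closed_segment 0 e"
                then have "norm x \<le> norm e" using segment_bound1[of x 0 e] by simp
                then have "norm x < R" using \<open>norm e = 3 / 4 * R\<close> R by simp
                obtain t where t: "0 \<le> t" "x = t *\<^sub>R e" using x by (auto simp: closed_segment_def)
                have "x \<notin> G"
                proof (cases "t = 0")
                  case True
                  then show ?thesis using t G by auto
                next
                  case False
                  then have "t * (3 / 4 * R / norm v) > 0" using t R v by simp
                  from v(2)[OF this] show ?thesis by (simp add: t e_def)
                qed
                then show "x \<in> {x \<in> ball 0 R. k x < k p1}"
                  using \<open>norm x < R\<close> p1(2)[of x] by (auto simp: G_def k_def)
              qed
            qed auto
            show "e \<noteq> 0" using \<open>norm e = 3 / 4 * R\<close> R by auto
            show "k e \<le> 0" using T_pos[of e] \<open>norm e = 3 / 4 * R\<close> R by (simp add: T_def k_def)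
          qed (use R compact_cball k_cont in \<open>auto simp: k_def\<close>)
          then obtain x where x: "norm x \<le> 3 / 4 * R" "0 < k x" "k x < k p1"
            "\<not> common_descent_direction k k x" by auto
          have "f' \<mu> x = 0"
          proof (rule ccontr)
            assume "f' \<mu> x \<noteq> 0"
            have "common_descent_direction (\<lambda>y. k y + 0) k x"
            proof (rule common_descent_direction_add_small_Lipschitz)
              show "(k has_derivative blinfun_apply (- f' \<mu> y)) (at y)" if "y \<in> B" for y
                unfolding k_def using deriv[OF elim(2) that]
                by (auto intro!: derivative_eq_intros simp: uminus_blinfun.rep_eq)
              show "continuous_on B (\<lambda>y. - f' \<mu> y)"
                using slice_continuous(2)[OF elim(2)] by (intro continuous_intros)
              show "0-lipschitz_on B (\<lambda>_. 0 :: real)" by (rule lipschitz_onI) auto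
              have "x \<in> cball 0 R" using x(1) R by simp
              then show "x \<in> B" using cball_B by blast
            qed (use \<open>f' \<mu> x \<noteq> 0\<close> in auto)
            with x(4) show False by simp
          qed
          moreover have "x \<in> cball 0 R" using x(1) R by simp
          ultimately have "x \<in> Z"
            using mem_critical_points_iff[OF elim(2), of x] cball_B cball_W by (auto simp: Z_def)
          moreover have "x \<noteq> 0" using x(2) by (auto simp: k_def)
          ultimately show ?thesis using x(3) by (auto simp: k_def)
        qed
        have "p1 \<in> Z - {0}" using G \<open>p1 \<in> G\<close> by blast
        have two: "\<exists>p2\<in>Z - {0}. p2 \<noteq> p1"
        proof (cases "G = {p1}")
          case True
          have "t *\<^sub>R (- p1) \<noteq> p1" if "t > 0" for t
          proof
            assume "t *\<^sub>R (- p1) = p1"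
            then have "(1 + t) *\<^sub>R p1 = t *\<^sub>R (- p1) + t *\<^sub>R p1" by (simp only: scaleR_add_left scaleR_one)
            then have "(1 + t) *\<^sub>R p1 = 0" by simp
            with that \<open>p1 \<in> Z - {0}\<close> show False by simp
          qed
          then have "t *\<^sub>R (- p1) \<notin> G" if "t > 0" for t using True that by blast
          moreover have "- p1 \<noteq> 0" using \<open>p1 \<in> Z - {0}\<close> by simp
          ultimately obtain p2 where "p2 \<in> Z - {0}" "f \<mu> p1 < f \<mu> p2" using second by blast
          then show ?thesis by (intro bexI[of _ p2]) auto
        next
          case False
          then obtain q where "q \<in> G" "q \<noteq> p1" using \<open>p1 \<in> G\<close> by blast
          then show ?thesis using G by blast
        qed
        have higher: "\<exists>p2\<in>Z - {0}. f \<mu> p1 < f \<mu> p2" if dim: "dim (UNIV :: 'a set) > 1"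
        proof -
          have "finite G" using True G finite_subset[of G Z] by blast
          then obtain v where "v \<noteq> 0" "\<And>t. t > 0 \<Longrightarrow> t *\<^sub>R v \<notin> G"
            using ray_avoiding_finite_set[OF _ dim] by metis
          then show ?thesis by (rule second)
        qed
        from two higher \<open>p1 \<in> Z - {0}\<close> strict1
        show "(\<exists>p1 p2. p1 \<noteq> p2 \<and> {p1, p2} \<subseteq> critical_points B (f \<mu>) \<inter> W - {0}) \<and>
           (finite (critical_points B (f \<mu>) \<inter> W) \<and> dim (UNIV :: 'a set) > 1 \<longrightarrow>
             (\<exists>p1 p2. p1 \<noteq> p2 \<and> {p1, p2} \<subseteq> critical_points B (f \<mu>) \<inter> W - {0} \<and>
                f \<mu> p2 > f \<mu> p1 \<and> strict_local_minimizer B (f \<mu>) p1))"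
          unfolding Z_def[symmetric] by force
      qed
    qed
  qed
qed

end

section \<open>Bifurcation\<close>

lemma one_sided_neighborhood_eventually:
  assumes "\<delta> > 0" and S: "S = {l<..l + \<delta>} \<or> S = {l - \<delta>..<l}"
    and ev: "\<forall>\<^sub>F \<mu> in at l within {l - \<delta>..l + \<delta>}. \<mu> \<in> S \<longrightarrow> P \<mu>"
  shows "\<exists>\<Lambda>. one_sided_neighborhood \<delta> l \<Lambda> \<and> (\<forall>\<mu>\<in>\<Lambda> - {l}. P \<mu>)"
proof -
  obtain d where d: "d > 0"
    "\<And>\<mu>. \<mu> \<in> {l - \<delta>..l + \<delta>} \<Longrightarrow> \<mu> \<noteq> l \<Longrightarrow> \<bar>\<mu> - l\<bar> < d \<Longrightarrow> \<mu> \<in> S \<longrightarrow> P \<mu>"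
    using ev unfolding eventually_at dist_real_def by blast
  define \<eta> where "\<eta> = min d \<delta>"
  have \<eta>: "\<eta> > 0" "\<eta> \<le> d" "\<eta> \<le> \<delta>" using d(1) \<open>\<delta> > 0\<close> by (auto simp: \<eta>_def)
  from S show ?thesis
  proof
    assume S: "S = {l<..l + \<delta>}"
    have "one_sided_neighborhood \<delta> l {l..<l + \<eta>}"
      unfolding one_sided_neighborhood_def
    proof
      show "is_interval {l..<l + \<eta>}" by (auto simp: is_interval_1)
      show "\<exists>\<eta>'>0. {l..<l + \<eta>'} \<subseteq> {l..<l + \<eta>} \<and> {l..<l + \<eta>} \<subseteq> {l..l + \<delta>} \<or>
          {l - \<eta>'<..l} \<subseteq> {l..<l + \<eta>} \<and> {l..<l + \<eta>} \<subseteq> {l - \<delta>..l}"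
        using \<eta> by (intro exI[of _ \<eta>]) auto
    qed
    moreover have "P \<mu>" if "\<mu> \<in> {l..<l + \<eta>} - {l}" for \<mu>
      using that d(2)[of \<mu>] \<eta> by (auto simp: S)
    ultimately show ?thesis by blast
  next
    assume S: "S = {l - \<delta>..<l}"
    have "one_sided_neighborhood \<delta> l {l - \<eta><..l}"
      unfolding one_sided_neighborhood_def
    proof
      show "is_interval {l - \<eta><..l}" by (auto simp: is_interval_1)
      show "\<exists>\<eta>'>0. {l..<l + \<eta>'} \<subseteq> {l - \<eta><..l} \<and> {l - \<eta><..l} \<subseteq> {l..l + \<delta>} \<or>
          {l - \<eta>'<..l} \<subseteq> {l - \<eta><..l} \<and> {l - \<eta><..l} \<subseteq> {l - \<delta>..l}"
        using \<eta> by (intro exI[of _ \<eta>]) auto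
    qed
    moreover have "P \<mu>" if "\<mu> \<in> {l - \<eta><..l} - {l}" for \<mu>
      using that d(2)[of \<mu>] \<eta> by (auto simp: S)
    ultimately show ?thesis by blast
  qed
qed

lemma at_within_one_side_nontrivial:
  fixes l \<delta> :: real
  assumes "\<delta> > 0" and S: "S = {l<..l + \<delta>} \<or> S = {l - \<delta>..<l}"
  shows "at l within S \<noteq> bot"
proof -
  have "l islimpt S"
    unfolding islimpt_approachable
  proof (intro allI impI)
    fix e :: real assume "e > 0"
    define t where "t = min \<delta> (e / 2)"
    have "0 < t" "t \<le> \<delta>" "t < e" using \<open>e > 0\<close> \<open>\<delta> > 0\<close> by (auto simp: t_def min_def)
    then have "l + t \<in> {l<..l + \<delta>}" "dist (l + t) l < e" "l - t \<in> {l - \<delta>..<l}" "dist (l - t) l < e"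
      by (auto simp: dist_real_def)
    moreover have "l + t \<noteq> l" "l - t \<noteq> l" using \<open>0 < t\<close> by auto
    ultimately show "\<exists>y\<in>S. y \<noteq> l \<and> dist y l < e" using S by blast
  qed
  then show ?thesis by (simp add: trivial_limit_within)
qed

context C1_family
begin

lemma bifurcation_point_if_small_critical_points:
  assumes "\<And>\<tau> r. \<tau> > 0 \<Longrightarrow> r > 0 \<Longrightarrow>
    \<exists>\<mu>\<in>I. \<bar>\<mu> - l\<bar> < \<tau> \<and> (\<exists>u\<in>critical_points B (f \<mu>) - {0}. norm u < r)"
  shows "bifurcation_point I B f' l"
  unfolding bifurcation_point_def
proof (intro conjI allI impI)
  show "(l, 0) \<in> I \<times> B" using l_in_I \<epsilon>_pos by simp
next
  fix N assume N: "openin (top_of_set (I \<times> B)) N \<and> (l, 0) \<in> N"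
  then obtain T where T: "open T" "N = (I \<times> B) \<inter> T" by (auto simp: openin_open)
  then obtain P Q where PQ: "open P" "open Q" "(l, 0) \<in> P \<times> Q" "P \<times> Q \<subseteq> T"
    using N open_prod_elim[of T "(l, 0)"] by auto
  obtain \<tau> where \<tau>: "\<tau> > 0" "ball l \<tau> \<subseteq> P" using PQ open_contains_ball by blast
  obtain r where r: "r > 0" "ball 0 r \<subseteq> Q" using PQ open_contains_ball by blast
  obtain \<mu> u where \<mu>u: "\<mu> \<in> I" "\<bar>\<mu> - l\<bar> < \<tau>" "u \<in> critical_points B (f \<mu>) - {0}" "norm u < r"
    using assms[OF \<tau>(1) r(1)] by blast
  have "\<mu> \<in> P" using \<mu>u(2) \<tau>(2) by (auto simp: subset_iff dist_real_def)
  moreover have "u \<in> Q" using \<mu>u(4) r(2) by (auto simp: subset_iff)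
  moreover have "u \<in> B" "f' \<mu> u = 0" using mem_critical_points_iff[OF \<mu>u(1)] \<mu>u(3) by auto
  ultimately show "\<exists>\<mu> u. (\<mu>, u) \<in> N \<and> u \<noteq> 0 \<and> f' \<mu> u = 0"
    using \<mu>u PQ(4) T(2) by blast
qed

lemma bifurcation_point_if_eventually_critical:
  assumes "S \<subseteq> I" and "at l within S \<noteq> bot"
    and "\<And>r. r > 0 \<Longrightarrow> \<forall>\<^sub>F \<mu> in at l within S. \<exists>u\<in>critical_points B (f \<mu>) - {0}. norm u < r"
  shows "bifurcation_point I B f' l"
proof (rule bifurcation_point_if_small_critical_points)
  fix \<tau> r :: real assume "\<tau> > 0" "r > 0"
  have "\<forall>\<^sub>F \<mu> in at l within S. \<mu> \<in> S \<and> \<bar>\<mu> - l\<bar> < \<tau>"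
    using \<open>\<tau> > 0\<close> by (auto simp: eventually_at dist_real_def)
  with assms(3)[OF \<open>r > 0\<close>]
  have "\<forall>\<^sub>F \<mu> in at l within S. \<mu> \<in> S \<and> \<bar>\<mu> - l\<bar> < \<tau> \<and> (\<exists>u\<in>critical_points B (f \<mu>) - {0}. norm u < r)"
    by eventually_elim blast
  from eventually_happens'[OF assms(2) this] obtain \<mu>
    where "\<mu> \<in> S" "\<bar>\<mu> - l\<bar> < \<tau>" "\<exists>u\<in>critical_points B (f \<mu>) - {0}. norm u < r"
    by auto
  then show "\<exists>\<mu>\<in>I. \<bar>\<mu> - l\<bar> < \<tau> \<and> (\<exists>u\<in>critical_points B (f \<mu>) - {0}. norm u < r)"
    using assms(1) by (intro bexI[of _ \<mu>] conjI) auto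
qed

lemma bifurcation_point_if_not_isolated:
  assumes "0 \<in> critical_points B (f l)" and "\<not> isolated_critical_point B (f l) 0"
  shows "bifurcation_point I B f' l"
proof (rule bifurcation_point_if_small_critical_points)
  fix \<tau> r :: real assume "\<tau> > 0" "r > 0"
  have "0 islimpt critical_points B (f l)"
    using assms by (simp add: isolated_critical_point_def isolated_in_islimpt_iff)
  then have "\<exists>u\<in>critical_points B (f l) - {0}. norm u < r"
    using \<open>r > 0\<close> unfolding islimpt_approachable by force
  with \<open>\<tau> > 0\<close> l_in_I show "\<exists>\<mu>\<in>I. \<bar>\<mu> - l\<bar> < \<tau> \<and> (\<exists>u\<in>critical_points B (f \<mu>) - {0}. norm u < r)"
    by force
qed

text \<open>
  The two critical points exist for all \<open>\<mu>\<close> close to \<open>l\<close> on the side \<open>S\<close>, which contains the required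
  one-sided neighborhood. Small balls in place of \<open>W\<close> show that they tend to \<open>0\<close>.
\<close>

lemma one_sided_branching_from_strict_minimum:
  assumes "\<delta> > 0" and I: "I = {l - \<delta>..l + \<delta>}"
    and S: "S = {l<..l + \<delta>} \<or> S = {l - \<delta>..<l}"
    and max: "\<forall>\<mu>\<in>S. local_maximizer B (f \<mu>) 0"
    and iso: "isolated_critical_point B (f l) 0" and min: "local_minimizer B (f l) 0"
  shows "\<forall>W. W \<subseteq> B \<and> 0 \<in> interior W \<longrightarrow>
          (\<exists>\<Lambda>. one_sided_neighborhood \<delta> l \<Lambda> \<and>
             (\<forall>\<mu>\<in>\<Lambda> - {l}. local_maximizer B (f \<mu>) 0 \<and>
                (\<exists>p1 p2. p1 \<noteq> p2 \<and> {p1, p2} \<subseteq> critical_points B (f \<mu>) \<inter> W - {0}) \<and>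
                (finite (critical_points B (f \<mu>) \<inter> W) \<and> dim (UNIV::'a set) > 1 \<longrightarrow>
                   (\<exists>p1 p2. p1 \<noteq> p2 \<and> {p1, p2} \<subseteq> critical_points B (f \<mu>) \<inter> W - {0} \<and>
                      f \<mu> p2 > f \<mu> p1 \<and> strict_local_minimizer B (f \<mu>) p1))))"
      (is "\<forall>W. _ \<longrightarrow> (\<exists>\<Lambda>. _ \<and> (\<forall>\<mu>\<in>_. _ \<and> ?P W \<mu>))")
    and "bifurcation_point I B f' l"
proof -
  have ev: "\<forall>\<^sub>F \<mu> in at l within I. \<mu> \<in> S \<longrightarrow> local_maximizer B (f \<mu>) 0 \<and> ?P W \<mu>"
    if "W \<subseteq> B" "0 \<in> interior W" for W
    using two_critical_points_if_strict_minimum_becomes_maximum[OF iso min that]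
  proof (rule eventually_mono)
    fix \<mu> assume "local_maximizer B (f \<mu>) 0 \<longrightarrow> ?P W \<mu>"
    then show "\<mu> \<in> S \<longrightarrow> local_maximizer B (f \<mu>) 0 \<and> ?P W \<mu>"
      using bspec[OF max] by (intro impI conjI[of "local_maximizer B (f \<mu>) 0"]) iprover+
  qed
  show "\<forall>W. W \<subseteq> B \<and> 0 \<in> interior W \<longrightarrow>
      (\<exists>\<Lambda>. one_sided_neighborhood \<delta> l \<Lambda> \<and> (\<forall>\<mu>\<in>\<Lambda> - {l}. local_maximizer B (f \<mu>) 0 \<and> ?P W \<mu>))"
  proof (intro allI impI, elim conjE)
    fix W assume W: "W \<subseteq> B" "0 \<in> interior W"
    show "\<exists>\<Lambda>. one_sided_neighborhood \<delta> l \<Lambda> \<and> (\<forall>\<mu>\<in>\<Lambda> - {l}. local_maximizer B (f \<mu>) 0 \<and> ?P W \<mu>)"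
      using ev[OF W] by (rule one_sided_neighborhood_eventually[OF \<open>\<delta> > 0\<close> S, folded I])
  qed
  show "bifurcation_point I B f' l"
  proof (rule bifurcation_point_if_eventually_critical)
    show "S \<subseteq> I" using S I by auto
    show "at l within S \<noteq> bot" using \<open>\<delta> > 0\<close> S by (rule at_within_one_side_nontrivial)
    fix r :: real assume "r > 0"
    have "ball 0 (min r \<epsilon>) \<subseteq> B" "(0 :: 'a) \<in> interior (ball 0 (min r \<epsilon>))"
      using \<open>r > 0\<close> \<epsilon>_pos by (auto simp: interior_open)
    from filter_leD[OF at_le[OF \<open>S \<subseteq> I\<close>] ev[OF this]]
    have "\<forall>\<^sub>F \<mu> in at l within S. \<mu> \<in> S \<longrightarrow> local_maximizer B (f \<mu>) 0 \<and> ?P (ball 0 (min r \<epsilon>)) \<mu>" .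
    moreover have "\<forall>\<^sub>F \<mu> in at l within S. \<mu> \<in> S" by (simp add: eventually_at_filter)
    ultimately show "\<forall>\<^sub>F \<mu> in at l within S. \<exists>u\<in>critical_points B (f \<mu>) - {0}. norm u < r"
    proof eventually_elim
      case (elim \<mu>)
      then obtain p1 p2 where "{p1, p2} \<subseteq> critical_points B (f \<mu>) \<inter> ball 0 (min r \<epsilon>) - {0}" by blast
      then show ?case by (intro bexI[of _ p1]) auto
    qed
  qed
qed

end

theorem theorem1p2:
  fixes f :: "real \<Rightarrow> 'a::real_normed_vector \<Rightarrow> real"
    and f' :: "real \<Rightarrow> 'a \<Rightarrow> 'a \<Rightarrow>\<^sub>L real"
    and \<delta> \<epsilon> l :: real
  defines "I \<equiv> {l - \<delta>..l + \<delta>}"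
    and "B \<equiv> ball (0::'a) \<epsilon>"
  assumes finite_dim: "\<exists>S::'a set. finite S \<and> span S = UNIV"
    and nontrivial: "(UNIV::'a set) \<noteq> {0}"
    and "\<delta> > 0" and "\<epsilon> > 0"
    and deriv: "\<And>\<mu> u. \<mu> \<in> I \<Longrightarrow> u \<in> B \<Longrightarrow> (f \<mu> has_derivative blinfun_apply (f' \<mu> u)) (at u)"
    and C1: "\<And>\<mu>. \<mu> \<in> I \<Longrightarrow> continuous_on B (f' \<mu>)"
    and cont_f: "continuous_on (I \<times> B) (\<lambda>(\<mu>, u). f \<mu> u)"
    and cont_f': "continuous_on (I \<times> B) (\<lambda>(\<mu>, u). f' \<mu> u)"
    and crit: "0 \<in> critical_points B (f l)"
    and extrema:
      "((\<forall>\<mu>\<in>{l<..l + \<delta>}. local_minimizer B (f \<mu>) 0) \<and> (\<forall>\<mu>\<in>{l - \<delta>..<l}. local_maximizer B (f \<mu>) 0)) \<or>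
       ((\<forall>\<mu>\<in>{l<..l + \<delta>}. local_maximizer B (f \<mu>) 0) \<and> (\<forall>\<mu>\<in>{l - \<delta>..<l}. local_minimizer B (f \<mu>) 0))"
  shows
    "(\<not> isolated_critical_point B (f l) 0
      \<or>
      (isolated_critical_point B (f l) 0 \<and> saddle_point B (f l) 0 \<and>
       (\<exists>u :: real \<Rightarrow> 'a.
          (\<forall>\<^sub>F \<mu> in at l within I. u \<mu> \<noteq> 0 \<and> u \<mu> \<in> critical_points B (f \<mu>)) \<and>
          (u \<longlongrightarrow> 0) (at l within I)))
      \<or>
      (isolated_critical_point B (f l) 0 \<and> local_minimizer B (f l) 0 \<and>
       (\<forall>W. W \<subseteq> B \<and> 0 \<in> interior W \<longrightarrow>
          (\<exists>\<Lambda>. one_sided_neighborhood \<delta> l \<Lambda> \<and>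
             (\<forall>\<mu>\<in>\<Lambda> - {l}. local_maximizer B (f \<mu>) 0 \<and>
                (\<exists>p1 p2. p1 \<noteq> p2 \<and> {p1, p2} \<subseteq> critical_points B (f \<mu>) \<inter> W - {0}) \<and>
                (finite (critical_points B (f \<mu>) \<inter> W) \<and> dim (UNIV::'a set) > 1 \<longrightarrow>
                   (\<exists>p1 p2. p1 \<noteq> p2 \<and> {p1, p2} \<subseteq> critical_points B (f \<mu>) \<inter> W - {0} \<and>
                      f \<mu> p2 > f \<mu> p1 \<and> strict_local_minimizer B (f \<mu>) p1))))))
      \<or>
      (isolated_critical_point B (f l) 0 \<and> local_maximizer B (f l) 0 \<and>
       (\<forall>W. W \<subseteq> B \<and> 0 \<in> interior W \<longrightarrow>
          (\<exists>\<Lambda>. one_sided_neighborhood \<delta> l \<Lambda> \<and>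
             (\<forall>\<mu>\<in>\<Lambda> - {l}. local_minimizer B (f \<mu>) 0 \<and>
                (\<exists>p1 p2. p1 \<noteq> p2 \<and> {p1, p2} \<subseteq> critical_points B (f \<mu>) \<inter> W - {0}) \<and>
                (finite (critical_points B (f \<mu>) \<inter> W) \<and> dim (UNIV::'a set) > 1 \<longrightarrow>
                   (\<exists>p1 p2. p1 \<noteq> p2 \<and> {p1, p2} \<subseteq> critical_points B (f \<mu>) \<inter> W - {0} \<and>
                      f \<mu> p2 < f \<mu> p1 \<and> strict_local_maximizer B (f \<mu>) p1)))))))
     \<and> bifurcation_point I B f' l"
proof -
  obtain S0 :: "'a set" where "finite S0" "span S0 = UNIV" using finite_dim by blast
  interpret F: C1_family f f' I l \<epsilon>
  proof
    show "compact (cball (0 :: 'a) r)" for r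
      using compact_cball_if_finite_span[OF \<open>finite S0\<close> \<open>span S0 = UNIV\<close>] .
  qed (use nontrivial \<open>\<delta> > 0\<close> \<open>\<epsilon> > 0\<close> deriv cont_f cont_f' in \<open>auto simp: I_def B_def\<close>)
  interpret N: C1_family "\<lambda>\<mu> u. - f \<mu> u" "\<lambda>\<mu> u. - f' \<mu> u" I l \<epsilon>
    by (rule F.C1_family_uminus)
  obtain Smin Smax where
    Smin: "Smin = {l<..l + \<delta>} \<or> Smin = {l - \<delta>..<l}" "\<forall>\<mu>\<in>Smin. local_minimizer B (f \<mu>) 0" and
    Smax: "Smax = {l<..l + \<delta>} \<or> Smax = {l - \<delta>..<l}" "\<forall>\<mu>\<in>Smax. local_maximizer B (f \<mu>) 0" and
    S_Un: "I = Smin \<union> {l} \<union> Smax"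
  proof (rule disjE[OF extrema])
    assume "(\<forall>\<mu>\<in>{l<..l + \<delta>}. local_minimizer B (f \<mu>) 0) \<and>
      (\<forall>\<mu>\<in>{l - \<delta>..<l}. local_maximizer B (f \<mu>) 0)"
    then show thesis using \<open>\<delta> > 0\<close> by (intro that[of "{l<..l + \<delta>}" "{l - \<delta>..<l}"]) (auto simp: I_def)
  next
    assume "(\<forall>\<mu>\<in>{l<..l + \<delta>}. local_maximizer B (f \<mu>) 0) \<and>
      (\<forall>\<mu>\<in>{l - \<delta>..<l}. local_minimizer B (f \<mu>) 0)"
    then show thesis using \<open>\<delta> > 0\<close> by (intro that[of "{l - \<delta>..<l}" "{l<..l + \<delta>}"]) (auto simp: I_def)
  qed
  have near_I: "at l within I \<noteq> bot"
  proof -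
    have "at l within Smin \<le> at l within I" using S_Un by (intro at_le) auto
    then show ?thesis using at_within_one_side_nontrivial[OF \<open>\<delta> > 0\<close> Smin(1)] by (metis bot.extremum_uniqueI)
  qed
  show ?thesis
  proof (cases "isolated_critical_point B (f l) 0")
    case False
    then show ?thesis
      using F.bifurcation_point_if_not_isolated crit by (simp add: B_def)
  next
    case iso: True
    consider "local_minimizer B (f l) 0" | "local_maximizer B (f l) 0"
      | "\<not> local_minimizer B (f l) 0" "\<not> local_maximizer B (f l) 0" by blast
    then show ?thesis
    proof cases
      case 1
      note branching = F.one_sided_branching_from_strict_minimum
        [OF \<open>\<delta> > 0\<close> I_def[THEN meta_eq_to_obj_eq] Smax(1), folded B_def, OF Smax(2) iso 1]
      show ?thesis
        by (rule conjI[OF disjI2[OF disjI2[OF disjI1[OF conjI[OF iso conjI[OF 1 branching(1)]]]]] branching(2)])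
    next
      case 2
      have "isolated_critical_point B (\<lambda>u. - f l u) 0" "local_minimizer B (\<lambda>u. - f l u) 0"
        "\<forall>\<mu>\<in>Smin. local_maximizer B (\<lambda>u. - f \<mu> u) 0"
        using iso 2 Smin(2) by simp_all
      from N.one_sided_branching_from_strict_minimum
        [OF \<open>\<delta> > 0\<close> I_def[THEN meta_eq_to_obj_eq] Smin(1), folded B_def, OF this(3,1,2)]
      have branching: "\<forall>W. W \<subseteq> B \<and> 0 \<in> interior W \<longrightarrow>
          (\<exists>\<Lambda>. one_sided_neighborhood \<delta> l \<Lambda> \<and>
             (\<forall>\<mu>\<in>\<Lambda> - {l}. local_minimizer B (f \<mu>) 0 \<and>
                (\<exists>p1 p2. p1 \<noteq> p2 \<and> {p1, p2} \<subseteq> critical_points B (f \<mu>) \<inter> W - {0}) \<and>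
                (finite (critical_points B (f \<mu>) \<inter> W) \<and> dim (UNIV::'a set) > 1 \<longrightarrow>
                   (\<exists>p1 p2. p1 \<noteq> p2 \<and> {p1, p2} \<subseteq> critical_points B (f \<mu>) \<inter> W - {0} \<and>
                      f \<mu> p2 < f \<mu> p1 \<and> strict_local_maximizer B (f \<mu>) p1))))"
        and bifurcation: "bifurcation_point I B f' l"
        unfolding critical_points_uminus extremum_uminus neg_less_iff_less
          bifurcation_point_def neg_equal_0_iff_equal by - assumption+
      show ?thesis
        by (rule conjI[OF disjI2[OF disjI2[OF disjI2[OF conjI[OF iso conjI[OF 2 branching]]]]] bifurcation])
    next
      case 3
      have "0 \<in> B" using \<open>\<epsilon> > 0\<close> by (simp add: B_def)
      have "open B" by (simp add: B_def)
      have saddle: "saddle_point B (f l) 0"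
        unfolding saddle_point_def
      proof (intro conjI allI impI crit)
        fix V :: "'a set" assume V: "open V \<and> 0 \<in> V"
        then have ev_V: "\<forall>\<^sub>F x in at 0 within B. x \<in> V \<inter> B"
          by (auto simp: eventually_at_topological)
        show "\<exists>v\<in>V \<inter> B. f l v - f l 0 > 0"
        proof (rule ccontr)
          assume "\<not> ?thesis"
          then have "f l x \<le> f l 0" if "x \<in> V \<inter> B" for x
            using that by (simp add: not_less)
          then have "\<forall>\<^sub>F x in at 0 within B. f l x \<le> f l 0"
            using ev_V by (rule eventually_mono[rotated])
          with 3 \<open>0 \<in> B\<close> show False by (simp add: local_maximizer_def)
        qed
        show "\<exists>v\<in>V \<inter> B. f l v - f l 0 < 0"
        proof (rule ccontr)
          assume "\<not> ?thesis"
          then have "f l 0 \<le> f l x" if "x \<in> V \<inter> B" for x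
            using that by (simp add: not_less)
          then have "\<forall>\<^sub>F x in at 0 within B. f l 0 \<le> f l x"
            using ev_V by (rule eventually_mono[rotated])
          with 3 \<open>0 \<in> B\<close> show False by (simp add: local_minimizer_def)
        qed
      qed
      have ev: "\<forall>\<^sub>F \<mu> in at l within I. \<exists>u\<in>critical_points B (f \<mu>) - {0}. norm u < r" if "r > 0" for r
      proof -
        have "\<forall>\<^sub>F \<mu> in at l within I. \<mu> \<in> Smin \<union> Smax"
          using S_Un by (auto simp: eventually_at_filter)
        moreover have "\<forall>\<^sub>F \<mu> in at l within I. local_minimizer B (f \<mu>) 0 \<longrightarrow>
            (\<exists>u\<in>critical_points B (f \<mu>) - {0}. norm u < r)"
          using F.nontrivial_critical_point_if_minimum_lost[OF _ _ that] iso 3 by (simp add: B_def)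
        moreover have "\<forall>\<^sub>F \<mu> in at l within I. local_maximizer B (f \<mu>) 0 \<longrightarrow>
            (\<exists>u\<in>critical_points B (f \<mu>) - {0}. norm u < r)"
          using N.nontrivial_critical_point_if_minimum_lost[OF _ _ that] iso 3 by (simp add: B_def)
        ultimately show ?thesis
        proof eventually_elim
          case (elim \<mu>)
          from elim(1) show ?case
          proof
            assume "\<mu> \<in> Smin"
            then show ?thesis using elim(2) Smin(2) by simp
          next
            assume "\<mu> \<in> Smax"
            then show ?thesis using elim(3) Smax(2) by simp
          qed
        qed
      qed
      have bifurcation: "bifurcation_point I B f' l"
        by (rule F.bifurcation_point_if_eventually_critical[OF order_refl near_I, folded B_def, OF ev])
      obtain u where u: "\<forall>\<^sub>F \<mu> in at l within I. u \<mu> \<in> critical_points B (f \<mu>) - {0}"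
        "(u \<longlongrightarrow> 0) (at l within I)"
        using selection_tending_to_zero[where Z = "\<lambda>\<mu>. critical_points B (f \<mu>) - {0}", OF ev] by blast
      have "\<forall>\<^sub>F \<mu> in at l within I. u \<mu> \<noteq> 0 \<and> u \<mu> \<in> critical_points B (f \<mu>)"
        using u(1) by (rule eventually_mono) simp
      then have "\<exists>u. (\<forall>\<^sub>F \<mu> in at l within I. u \<mu> \<noteq> 0 \<and> u \<mu> \<in> critical_points B (f \<mu>)) \<and>
          (u \<longlongrightarrow> 0) (at l within I)"
        using u(2) by (intro exI[of _ u] conjI)
      then show ?thesis
        by (intro conjI[OF disjI2[OF disjI1[OF conjI[OF iso conjI[OF saddle]]]] bifurcation])
    qed
  qed
qed

end
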